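(* For every positive integer $n$, there exists an $\mathrm{mcDSQS}(2\cdot 9^{n}+2)$.
   Context: A Steiner triple system $\mathrm{STS}(v)$ is a pair $(X,\mathcal{B})$ with $|X|=v$ and $\mathcal{B}$ a set of $3$-subsets (blocks) such that every $2$-subset of $X$ lies in exactly one block. A Steiner quadruple system $\mathrm{SQS}(v)$ is $(X,\mathcal{B})$ with $\mathcal{B}$ a set of $4$-subsets such that every $3$-subset lies in exactly one block; for $x\in X$ its derived design at $x$ is the $\mathrm{STS}(v-1)$ $(X\setminus\{x\},\{B\setminus\{x\}:x\in B\in\mathcal{B}\})$. A partial parallel class (PPC) of a set $Y$ is a collection of pairwise disjoint blocks contained in $Y$. An $r$-coloring of a design is a partition of its block set into $r$ PPCs of its point set. The chromatic index $\chi'(v)$ is the minimum, over all $\mathrm{STS}(v)$, of the least $r$ such that the $\mathrm{STS}(v)$ admits an $r$-coloring. An $\mathrm{STS}(v)$ admitting a $\chi'(v)$-coloring is called minimum colorable ($\mathrm{mcSTS}(v)$). An $\mathrm{mcDSQS}(v)$ is an $\mathrm{SQS}(v)$ whose derived design at every point is an $\mathrm{mcSTS}(v-1)$. *)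

theory Defs
  imports Main
begin

definition STS :: "nat \<Rightarrow> 'a set \<Rightarrow> 'a set set \<Rightarrow> bool" where
  "STS v X B \<longleftrightarrow> finite X \<and> card X = v \<and>
     (\<forall>b\<in>B. b \<subseteq> X \<and> card b = 3) \<and>
     (\<forall>p. p \<subseteq> X \<and> card p = 2 \<longrightarrow> (\<exists>!b. b \<in> B \<and> p \<subseteq> b))"

definition SQS :: "nat \<Rightarrow> 'a set \<Rightarrow> 'a set set \<Rightarrow> bool" where
  "SQS v X B \<longleftrightarrow> finite X \<and> card X = v \<and>
     (\<forall>b\<in>B. b \<subseteq> X \<and> card b = 4) \<and>
     (\<forall>t. t \<subseteq> X \<and> card t = 3 \<longrightarrow> (\<exists>!b. b \<in> B \<and> t \<subseteq> b))"

definition derived_blocks :: "'a set set \<Rightarrow> 'a \<Rightarrow> 'a set set" where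
  "derived_blocks B x = {b - {x} | b. b \<in> B \<and> x \<in> b}"

definition PPC :: "'a set \<Rightarrow> 'a set set \<Rightarrow> bool" where
  "PPC Y C \<longleftrightarrow> (\<forall>b\<in>C. b \<subseteq> Y) \<and> (\<forall>b1\<in>C. \<forall>b2\<in>C. b1 \<noteq> b2 \<longrightarrow> b1 \<inter> b2 = {})"

definition colorable :: "nat \<Rightarrow> 'a set \<Rightarrow> 'a set set \<Rightarrow> bool" where
  "colorable r X B \<longleftrightarrow> (\<exists>c :: 'a set \<Rightarrow> nat.
      (\<forall>b\<in>B. c b < r) \<and> (\<forall>i<r. PPC X {b \<in> B. c b = i}))"

(* chromatic index chi'(v): minimum over all STS(v) of the least r admitting an r-coloring
   (points taken w.l.o.g. from nat, the notion being isomorphism invariant) *)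
definition chromatic_index :: "nat \<Rightarrow> nat" where
  "chromatic_index v = (LEAST r. \<exists>(X :: nat set) B. STS v X B \<and> colorable r X B)"

definition mcSTS :: "nat \<Rightarrow> 'a set \<Rightarrow> 'a set set \<Rightarrow> bool" where
  "mcSTS v X B \<longleftrightarrow> STS v X B \<and> colorable (chromatic_index v) X B"

definition mcDSQS :: "nat \<Rightarrow> 'a set \<Rightarrow> 'a set set \<Rightarrow> bool" where
  "mcDSQS v X B \<longleftrightarrow> SQS v X B \<and>
     (\<forall>x\<in>X. mcSTS (v - 1) (X - {x}) (derived_blocks B x))"

end

theory Submission
  imports Defs "HOL-Algebra.Algebraic_Closure_Type"
begin

text \<open>
  Let \<open>P\<close> be the projective line over the field with \<open>q = 9\<^sup>n\<close> elements. The images of the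
  projective line over the subfield of order 9 are the circles of a 3-design: three points of \<open>P\<close>
  lie on exactly one circle, and every circle has 10 points. Put a quadruple system on 20 points
  containing all unions of two fibres over every circle. Two circles share at most two points, so
  these systems agree where they overlap and form an \<open>SQS(2q + 2)\<close> on \<open>P \<times> bool\<close>.

  A triple system on \<open>2q + 1\<close> points needs at least \<open>q + 1\<close> colours, as a partial parallel class
  has at most \<open>2q / 3\<close> blocks. To reach this bound for the derived design at a point over \<open>x\<close>,
  choose a second point \<open>y x\<close> of \<open>P\<close>. The circles through \<open>x\<close> are the lines of an affine space, in
  which those through \<open>y x\<close> represent the parallel classes. If the part of the derived design over
  each line missing \<open>y x\<close> splits into 8 parallel classes, then the lines parallel to a given line
  through \<open>y x\<close> can use the 8 points of that line other than \<open>x\<close> and \<open>y x\<close> as colours. The blocks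
  over a line through \<open>y x\<close> use the same 8 colours and two more, common to all these lines.

  With \<open>y x = \<infinity>\<close> for finite \<open>x\<close> and \<open>y \<infinity> = 0\<close>, three systems on 20 points, according to which
  of \<open>0\<close> and \<open>\<infinity>\<close> lie on the circle, have the required colourings. They were found by a computer
  search.
\<close>

text \<open>The notation of HOL-Algebra makes \<open>X\<close> a keyword.\<close>
no_notation var (\<open>X\<index>\<close>)

section \<open>Designs and colourings\<close>

lemma ex1_obtain:
  assumes "\<exists>!b. P b"
  obtains b where "P b" "\<And>b'. P b' \<Longrightarrow> b' = b"
  using assms by (rule ex1E) blast

lemma STSI:
  assumes "finite X" "card X = v" "\<And>b. b \<in> B \<Longrightarrow> b \<subseteq> X \<and> card b = 3"
    "\<And>p. p \<subseteq> X \<Longrightarrow> card p = 2 \<Longrightarrow> \<exists>!b. b \<in> B \<and> p \<subseteq> b"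
  shows "STS v X B"
  unfolding STS_def by (intro conjI ballI allI impI) (use assms in \<open>simp_all only:\<close>)

lemma SQSI:
  assumes "finite X" "card X = v" "\<And>b. b \<in> B \<Longrightarrow> b \<subseteq> X \<and> card b = 4"
    "\<And>t. t \<subseteq> X \<Longrightarrow> card t = 3 \<Longrightarrow> \<exists>!b. b \<in> B \<and> t \<subseteq> b"
  shows "SQS v X B"
  unfolding SQS_def by (intro conjI ballI allI impI) (use assms in \<open>simp_all only:\<close>)

text \<open>The derived blocks containing a pair \<open>p\<close> correspond to the blocks of
  \<open>B\<close> containing the triple \<open>insert x p\<close>, of which there is exactly
  one.\<close>

lemma SQS_imp_derived_STS:
  assumes "SQS (v + 1) X B" "x \<in> X"
  shows "STS v (X - {x}) (derived_blocks B x)"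
proof -
  have X: "finite X" "card X = v + 1" and B: "\<And>b. b \<in> B \<Longrightarrow> b \<subseteq> X \<and> card b = 4"
    and ex1: "\<And>t. t \<subseteq> X \<Longrightarrow> card t = 3 \<Longrightarrow> \<exists>!b. b \<in> B \<and> t \<subseteq> b"
    using assms(1) unfolding SQS_def by blast+
  have fin: "finite b" if "b \<in> B" for b
    using B[OF that] X(1) finite_subset by blast
  have "\<exists>!d. d \<in> derived_blocks B x \<and> p \<subseteq> d" if p: "p \<subseteq> X - {x}" "card p = 2" for p
  proof -
    have "finite p" by (rule finite_subset[OF p(1)]) (use X(1) in simp)
    moreover have "x \<notin> p" using p(1) by blast
    ultimately have card: "card (insert x p) = 3" using p(2) by simp
    have "insert x p \<subseteq> X" using p(1) assms(2) by blast
    from ex1[OF this card] obtain b where b: "b \<in> B \<and> insert x p \<subseteq> b"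
      and uniq: "\<And>b'. b' \<in> B \<and> insert x p \<subseteq> b' \<Longrightarrow> b' = b"
      by (rule ex1_obtain) (rule that)
    show ?thesis
    proof (rule ex1I[of _ "b - {x}"])
      show "b - {x} \<in> derived_blocks B x \<and> p \<subseteq> b - {x}"
        using b p by (auto simp: derived_blocks_def)
    next
      fix d assume "d \<in> derived_blocks B x \<and> p \<subseteq> d"
      then obtain b' where "b' \<in> B" "x \<in> b'" "d = b' - {x}" "p \<subseteq> d"
        by (auto simp: derived_blocks_def)
      moreover from this have "b' = b" by (intro uniq) auto
      ultimately show "d = b - {x}" by simp
    qed
  qed
  moreover have "d \<subseteq> X - {x} \<and> card d = 3" if "d \<in> derived_blocks B x" for d
    using that B fin by (auto simp: derived_blocks_def)
  moreover have "finite (X - {x})" "card (X - {x}) = v"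
    using X assms(2) by auto
  ultimately show ?thesis by (intro STSI)
qed

text \<open>Double counting: every pair lies in exactly one block, and a block covers three
  pairs.\<close>

lemma STS_card_blocks:
  assumes "STS v X B"
  shows "3 * card B = v choose 2"
proof -
  have X: "finite X" "card X = v" and B: "\<And>b. b \<in> B \<Longrightarrow> b \<subseteq> X \<and> card b = 3"
    and ex1: "\<And>p. p \<subseteq> X \<Longrightarrow> card p = 2 \<Longrightarrow> \<exists>!b. b \<in> B \<and> p \<subseteq> b"
    using assms(1) unfolding STS_def by blast+
  have fin: "finite b" if "b \<in> B" for b
    using B[OF that] X(1) finite_subset by blast
  have finB: "finite B"
    using B X(1) by (intro finite_subset[of B "Pow X"]) auto
  have eq: "{p. p \<subseteq> X \<and> card p = 2} = (\<Union>b\<in>B. {p. p \<subseteq> b \<and> card p = 2})"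
  proof (intro equalityI subsetI)
    fix p assume "p \<in> {p. p \<subseteq> X \<and> card p = 2}"
    hence p: "p \<subseteq> X" "card p = 2" by auto
    show "p \<in> (\<Union>b\<in>B. {p. p \<subseteq> b \<and> card p = 2})"
      using ex1[OF p] p by auto
  next
    fix p assume "p \<in> (\<Union>b\<in>B. {p. p \<subseteq> b \<and> card p = 2})"
    thus "p \<in> {p. p \<subseteq> X \<and> card p = 2}" using B by fastforce
  qed
  have "v choose 2 = card {p. p \<subseteq> X \<and> card p = 2}"
    using n_subsets[OF X(1), of 2] X(2) by simp
  also have "\<dots> = (\<Sum>b\<in>B. card {p. p \<subseteq> b \<and> card p = 2})"
    unfolding eq
  proof (rule card_UN_disjoint[OF finB])
    show "\<forall>b\<in>B. finite {p. p \<subseteq> b \<and> card p = 2}"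
      using fin by auto
    show "\<forall>b\<in>B. \<forall>b'\<in>B. b \<noteq> b' \<longrightarrow>
        {p. p \<subseteq> b \<and> card p = 2} \<inter> {p. p \<subseteq> b' \<and> card p = 2} = {}"
    proof (intro ballI impI equals0I)
      fix b b' p assume "b \<in> B" "b' \<in> B" "b \<noteq> b'"
        "p \<in> {p. p \<subseteq> b \<and> card p = 2} \<inter> {p. p \<subseteq> b' \<and> card p = 2}"
      moreover from this have "p \<subseteq> X" using B by auto
      ultimately show False using ex1[of p] by auto
    qed
  qed
  also have "\<dots> = (\<Sum>b\<in>B. 3)"
  proof (rule sum.cong[OF refl])
    fix b assume "b \<in> B"
    thus "card {p. p \<subseteq> b \<and> card p = 2} = 3"
      using n_subsets[OF fin, of b 2] B by (auto simp: eval_nat_numeral)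
  qed
  finally show ?thesis by simp
qed

text \<open>With \<open>q = 3 * m\<close>, a class of disjoint triples on \<open>6 * m + 1\<close>
  points has at most \<open>2 * m\<close> members, while there are \<open>m * (6 * m + 1)\<close>
  blocks. The resulting bound \<open>6 * m + 1 \<le> 2 * r\<close> gains its last unit from
  parity.\<close>

lemma STS_colorable_lower_bound:
  assumes "STS (2 * q + 1) X B" "3 dvd q" "q > 0" "colorable r X B"
  shows "q + 1 \<le> r"
proof -
  have X: "finite X" "card X = 2 * q + 1" and B: "\<And>b. b \<in> B \<Longrightarrow> b \<subseteq> X \<and> card b = 3"
    using assms(1) unfolding STS_def by blast+
  have finB: "finite B"
    using B X(1) by (intro finite_subset[of B "Pow X"]) auto
  obtain m where m: "q = 3 * m" using assms(2) by (elim dvdE)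
  obtain c where c: "\<And>b. b \<in> B \<Longrightarrow> c b < r" "\<And>i. i < r \<Longrightarrow> PPC X {b \<in> B. c b = i}"
    using assms(4) by (auto simp: colorable_def)
  have class_le: "card {b \<in> B. c b = i} \<le> 2 * m" if "i < r" for i
  proof -
    let ?C = "{b \<in> B. c b = i}"
    have "card (\<Union>?C) = sum card ?C"
    proof (rule card_Union_disjoint)
      show "pairwise disjnt ?C"
        using c(2)[OF that] by (auto simp: PPC_def pairwise_def disjnt_def)
      show "finite A" if "A \<in> ?C" for A
        using that B X(1) finite_subset by blast
    qed
    also have "\<dots> = 3 * card ?C" using B by simp
    finally have "3 * card ?C \<le> card X"
      using card_mono[OF X(1), of "\<Union>?C"] B by auto
    thus ?thesis using X(2) m by linarith
  qed
  \<comment> \<open>The constant 1 is summed over the blocks, grouped by colour.\<close>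
  have "card B = (\<Sum>i<r. card {b \<in> B. c b = i})"
    using sum_fun_comp[of B "{..<r}" c "\<lambda>_. 1 :: nat"] finB c(1) by auto
  also have "\<dots> \<le> (\<Sum>i<r. 2 * m)" by (intro sum_mono class_le) auto
  finally have "card B \<le> 2 * m * r" by (simp add: mult_ac)
  moreover have "3 * card B = 3 * m * (2 * q + 1)"
    using STS_card_blocks[OF assms(1)] m by (simp add: choose_two)
  ultimately have "m * (6 * m + 1) \<le> m * (2 * r)" using m by simp
  hence "6 * m + 1 \<le> 2 * r" using assms(3) m by (subst (asm) mult_le_cancel1) auto
  thus ?thesis using m by simp
qed

text \<open>The lower bound holds for every system, so a single system that reaches it fixes the
  index.\<close>

lemma chromatic_index_eqI:
  assumes "STS (2 * q + 1) (X :: nat set) B" "colorable (q + 1) X B" "3 dvd q" "q > 0"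
  shows "chromatic_index (2 * q + 1) = q + 1"
  unfolding chromatic_index_def
  by (rule Least_equality) (use assms STS_colorable_lower_bound in blast)+

lemma mcDSQSI:
  assumes "SQS (2 * q + 2) (X :: nat set) B" "3 dvd q" "q > 0"
    and col: "\<And>x. x \<in> X \<Longrightarrow> colorable (q + 1) (X - {x}) (derived_blocks B x)"
  shows "mcDSQS (2 * q + 2) X B"
proof -
  have "STS (2 * q + 1) (X - {x}) (derived_blocks B x)" if "x \<in> X" for x
    using SQS_imp_derived_STS[of "2 * q + 1"] assms(1) that by simp
  moreover from this have "chromatic_index (2 * q + 1) = q + 1" if "x \<in> X" for x
    using that assms(2,3) col by (intro chromatic_index_eqI) auto
  ultimately show ?thesis
    using assms(1) col unfolding mcDSQS_def mcSTS_def by simp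
qed

section \<open>Colourings with arbitrary colours\<close>

definition proper_coloring :: "('a set \<Rightarrow> 'c) \<Rightarrow> 'a set set \<Rightarrow> bool" where
  "proper_coloring c D \<longleftrightarrow> (\<forall>b1\<in>D. \<forall>b2\<in>D. c b1 = c b2 \<longrightarrow> b1 \<noteq> b2 \<longrightarrow> b1 \<inter> b2 = {})"

text \<open>A bijection of the finite colour set with an initial segment of the naturals supplies
  the numbers that \<open>colorable\<close> asks for. This allows points of the projective line to
  serve as colours.\<close>

lemma colorableI:
  assumes "proper_coloring c B" "\<And>b. b \<in> B \<Longrightarrow> b \<subseteq> X" "c ` B \<subseteq> L" "finite L" "card L \<le> r"
  shows "colorable r X B"
proof -
  obtain g :: "_ \<Rightarrow> nat" where g: "bij_betw g L {0..<card L}"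
    using ex_bij_betw_finite_nat[OF assms(4)] by blast
  have inj: "c b1 = c b2" if "b1 \<in> B" "b2 \<in> B" "g (c b1) = g (c b2)" for b1 b2
    using that g assms(3) by (metis bij_betw_imp_inj_on image_subset_iff inj_onD)
  have "g (c b) < r" if "b \<in> B" for b
    using that bij_betwE[OF g] assms(3,5) by (force simp: image_subset_iff)
  thus ?thesis
    unfolding colorable_def PPC_def
  proof (intro exI[of _ "g \<circ> c"] conjI ballI allI impI)
    fix i b1 b2 assume "b1 \<in> {b \<in> B. (g \<circ> c) b = i}" "b2 \<in> {b \<in> B. (g \<circ> c) b = i}" "b1 \<noteq> b2"
    moreover from this have "c b1 = c b2" by (intro inj) auto
    ultimately show "b1 \<inter> b2 = {}" using assms(1) by (simp add: proper_coloring_def)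
  qed (use assms(2) in auto)
qed

lemma colorable_obtain:
  assumes "colorable r X B"
  obtains c where "proper_coloring c B" "c ` B \<subseteq> {..<r}"
proof -
  obtain c where c: "\<And>b. b \<in> B \<Longrightarrow> c b < r" "\<And>i. i < r \<Longrightarrow> PPC X {b \<in> B. c b = i}"
    using assms by (auto simp: colorable_def)
  have "b1 \<inter> b2 = {}" if "b1 \<in> B" "b2 \<in> B" "c b1 = c b2" "b1 \<noteq> b2" for b1 b2
    using c(2)[OF c(1)[OF that(1)]] that by (auto simp: PPC_def)
  hence "proper_coloring c B" by (simp add: proper_coloring_def)
  thus ?thesis using c(1) that by blast
qed

section \<open>Transport of designs and colourings along injections\<close>

lemma inj_on_subset_image_iff:
  assumes "inj_on f X" "s \<subseteq> X" "b \<subseteq> X"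
  shows "s \<subseteq> b \<longleftrightarrow> f ` s \<subseteq> f ` b"
  using assms inj_on_image_mem_iff[OF assms(1) _ assms(3)] by blast

lemma SQS_image:
  assumes "SQS v X B" "inj_on f X"
  shows "SQS v (f ` X) ((`) f ` B)"
proof -
  have X: "finite X" "card X = v" and B: "\<And>b. b \<in> B \<Longrightarrow> b \<subseteq> X \<and> card b = 4"
    and ex1: "\<And>t. t \<subseteq> X \<Longrightarrow> card t = 3 \<Longrightarrow> \<exists>!b. b \<in> B \<and> t \<subseteq> b"
    using assms(1) unfolding SQS_def by blast+
  have "\<exists>!b. b \<in> (`) f ` B \<and> t \<subseteq> b" if t: "t \<subseteq> f ` X" "card t = 3" for t
  proof -
    obtain s where s: "s \<subseteq> X" "t = f ` s" using t(1) by (auto simp: subset_image_iff)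
    have "card s = 3" using s t(2) assms(2) by (metis card_image inj_on_subset)
    from ex1[OF s(1) this] obtain b where b: "b \<in> B \<and> s \<subseteq> b"
      and uniq: "\<And>b'. b' \<in> B \<and> s \<subseteq> b' \<Longrightarrow> b' = b"
      by (rule ex1_obtain) (rule that)
    have sub: "s \<subseteq> b'" if "b' \<in> B" "t \<subseteq> f ` b'" for b'
      using inj_on_subset_image_iff[OF assms(2) s(1), of b'] B[OF that(1)] that(2) s(2) by simp
    show ?thesis
    proof (rule ex1I[of _ "f ` b"])
      show "f ` b \<in> (`) f ` B \<and> t \<subseteq> f ` b" using b s(2) by blast
    next
      fix e assume "e \<in> (`) f ` B \<and> t \<subseteq> e"
      then obtain b' where b': "b' \<in> B" "e = f ` b'" "t \<subseteq> f ` b'" by blast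
      have "b' = b" using uniq b'(1) sub[OF b'(1,3)] by simp
      thus "e = f ` b" using b'(2) by simp
    qed
  qed
  moreover have "b \<subseteq> f ` X \<and> card b = 4" if "b \<in> (`) f ` B" for b
  proof -
    obtain b0 where "b0 \<in> B" "b = f ` b0" using \<open>b \<in> (`) f ` B\<close> by blast
    thus ?thesis using B[of b0] card_image[OF inj_on_subset[OF assms(2)], of b0] by auto
  qed
  moreover have "finite (f ` X)" "card (f ` X) = v"
    using X assms(2) by (auto simp: card_image)
  ultimately show ?thesis by (intro SQSI)
qed

lemma derived_blocks_image:
  assumes "\<And>b. b \<in> B \<Longrightarrow> b \<subseteq> X" "inj_on f X" "x \<in> X"
  shows "derived_blocks ((`) f ` B) (f x) = (`) f ` derived_blocks B x"
proof -
  have mem: "f x \<in> f ` b \<longleftrightarrow> x \<in> b" if "b \<in> B" for b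
    using assms that by (auto simp: inj_on_image_mem_iff)
  have diff: "f ` b - {f x} = f ` (b - {x})" if "b \<in> B" for b
    using inj_on_image_set_diff[OF assms(2), of b "{x}"] assms(1)[OF that] assms(3) by auto
  have "derived_blocks ((`) f ` B) (f x) = {f ` b - {f x} |b. b \<in> B \<and> f x \<in> f ` b}"
    by (auto simp: derived_blocks_def)
  also have "\<dots> = {f ` (b - {x}) |b. b \<in> B \<and> x \<in> b}"
    using mem diff by (intro Collect_cong ex_cong1) auto
  finally show ?thesis
    by (auto simp: derived_blocks_def)
qed

lemma proper_coloring_image:
  assumes "proper_coloring c D" "\<And>d. d \<in> D \<Longrightarrow> d \<subseteq> X" "inj_on f X"
  obtains c' where "proper_coloring c' ((`) f ` D)" "\<And>d. d \<in> D \<Longrightarrow> c' (f ` d) = c d"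
proof
  \<comment> \<open>As \<open>f\<close> is injective only on \<open>X\<close>, the preimage is cut
    down to \<open>X\<close> to recover a block from its image.\<close>
  let ?c = "\<lambda>e. c (f -` e \<inter> X)"
  show eq: "?c (f ` d) = c d" if "d \<in> D" for d
  proof -
    have "f -` (f ` d) \<inter> X = d" using assms(2)[OF that] assms(3) by (auto simp: inj_on_def)
    thus ?thesis by simp
  qed
  show "proper_coloring ?c ((`) f ` D)"
    unfolding proper_coloring_def
  proof (intro ballI impI)
    fix e1 e2 assume "e1 \<in> (`) f ` D" "e2 \<in> (`) f ` D" and h: "?c e1 = ?c e2" "e1 \<noteq> e2"
    then obtain d1 d2 where d: "d1 \<in> D" "d2 \<in> D" "e1 = f ` d1" "e2 = f ` d2" by auto
    have "c d1 = c d2" "d1 \<noteq> d2" using h eq[OF d(1)] eq[OF d(2)] d(3,4) by auto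
    hence "d1 \<inter> d2 = {}" 
      using assms(1) d(1,2) unfolding proper_coloring_def by blast
    thus "e1 \<inter> e2 = {}"
      using d inj_on_image_Int[OF assms(3) assms(2)[of d1] assms(2)[of d2]] by simp
  qed
qed

lemma colorable_image:
  assumes "colorable r X B" "inj_on f X" "\<And>b. b \<in> B \<Longrightarrow> b \<subseteq> X"
  shows "colorable r (f ` X) ((`) f ` B)"
proof -
  obtain c where c: "proper_coloring c B" "c ` B \<subseteq> {..<r}"
    using colorable_obtain[OF assms(1)] by blast
  obtain c' where "proper_coloring c' ((`) f ` B)" "\<And>b. b \<in> B \<Longrightarrow> c' (f ` b) = c b"
    using proper_coloring_image[OF c(1) assms(3,2)] by blast
  thus ?thesis
    using assms(3) c(2) by (intro colorableI[of c' _ _ "{..<r}"]) auto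
qed

text \<open>\<open>chromatic_index\<close> ranges over systems on natural numbers. The design is
  built on a convenient type and then moved along an injection into the naturals.\<close>

lemma mcDSQS_transfer:
  assumes "SQS (2 * q + 2) (X :: 'a set) B" "3 dvd q" "q > 0"
    and col: "\<And>x. x \<in> X \<Longrightarrow> colorable (q + 1) (X - {x}) (derived_blocks B x)"
  shows "\<exists>(X :: nat set) B. mcDSQS (2 * q + 2) X B"
proof -
  have X: "finite X" and B: "\<And>b. b \<in> B \<Longrightarrow> b \<subseteq> X"
    using assms(1) unfolding SQS_def by blast+
  obtain f :: "'a \<Rightarrow> nat" where f: "inj_on f X"
    using finite_imp_inj_to_nat_seg[OF X] by auto
  have "mcDSQS (2 * q + 2) (f ` X) ((`) f ` B)"
  proof (rule mcDSQSI[OF SQS_image[OF assms(1) f] assms(2,3)])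
    fix y assume "y \<in> f ` X"
    then obtain x where x: "x \<in> X" "y = f x" by auto
    have "d \<subseteq> X - {x}" if "d \<in> derived_blocks B x" for d
      using that B unfolding derived_blocks_def by blast
    hence "colorable (q + 1) (f ` (X - {x})) ((`) f ` derived_blocks B x)"
      by (intro colorable_image[OF col[OF x(1)] inj_on_diff[OF f]])
    moreover have "f ` (X - {x}) = f ` X - {y}"
      using inj_on_image_set_diff[OF f, of X "{x}"] x by simp
    ultimately show "colorable (q + 1) (f ` X - {y}) (derived_blocks ((`) f ` B) y)"
      using derived_blocks_image[OF B f x(1)] x(2) by simp
  qed
  thus ?thesis by blast
qed

section \<open>Gluing designs along the circles of a 3-design\<close>

text \<open>\<open>x'\<close> stands for the other point of the fibre of \<open>x\<close>. In a
  quadruple system on 20 points, 48 of the 57 derived blocks at \<open>x\<close> miss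
  \<open>x'\<close>. Disjointness allows six blocks per colour, so eight colours suffice only if
  each class partitions the 18 points other than \<open>x\<close> and \<open>x'\<close>.\<close>

definition resolvable_at :: "'a set set \<Rightarrow> 'a \<Rightarrow> 'a \<Rightarrow> bool" where
  "resolvable_at S x x' \<longleftrightarrow> (\<exists>c :: 'a set \<Rightarrow> nat.
     proper_coloring c {d \<in> derived_blocks S x. x' \<notin> d} \<and>
     (\<forall>d\<in>derived_blocks S x. x' \<notin> d \<longrightarrow> c d < 8))"

text \<open>\<open>s\<close> is the block shared by all systems over the circles through \<open>x\<close> and \<open>y x\<close>. Colours 8 and 9
  are those common to all these circles, so no other block meeting \<open>s\<close> may have them.\<close>

definition hanani_at :: "'a set set \<Rightarrow> 'a \<Rightarrow> 'a set \<Rightarrow> bool" where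
  "hanani_at S x s \<longleftrightarrow> (\<exists>c :: 'a set \<Rightarrow> nat.
     proper_coloring c (derived_blocks S x) \<and>
     (\<forall>d\<in>derived_blocks S x. c d < 10 \<and>
        (d \<inter> s \<noteq> {} \<longrightarrow> (if d = s then c d = 8 else c d < 8))))"

abbreviation fiber :: "'p \<Rightarrow> ('p \<times> bool) set" where
  "fiber x \<equiv> {(x, False), (x, True)}"

lemma fiber_split: "fiber x = {(x, i), (x, \<not> i)}"
  by (cases i) auto

lemma SQS_unique:
  assumes "SQS v X B" "b \<in> B" "b' \<in> B" "t \<subseteq> b" "t \<subseteq> b'" "card t = 3"
  shows "b = b'"
proof -
  have "b \<subseteq> X" using assms(1,2) unfolding SQS_def by blast
  hence "t \<subseteq> X" using assms(4) by blast
  moreover have "\<forall>t. t \<subseteq> X \<and> card t = 3 \<longrightarrow> (\<exists>!b. b \<in> B \<and> t \<subseteq> b)"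
    using assms(1) unfolding SQS_def by (elim conjE)
  ultimately have "\<exists>!b. b \<in> B \<and> t \<subseteq> b" using assms(6) by simp
  then obtain b0 where "\<And>b''. b'' \<in> B \<and> t \<subseteq> b'' \<Longrightarrow> b'' = b0"
    by (rule ex1_obtain) (rule that)
  thus ?thesis using assms(2-5) by metis
qed

text \<open>The circles through \<open>x\<close>, with \<open>x\<close> deleted, play the part of
  affine lines, and \<open>par x C\<close> that of the line through \<open>y x\<close> parallel to
  \<open>C\<close>. By \<open>local_pairs\<close>, the systems over all circles through
  \<open>x\<close> and \<open>z\<close> share the block formed by the fibres of \<open>x\<close> and
  \<open>z\<close>.\<close>

locale doubled_geometry =
  fixes P :: "'p set" and circs :: "'p set set" and S :: "'p set \<Rightarrow> ('p \<times> bool) set set"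
    and y :: "'p \<Rightarrow> 'p" and par :: "'p \<Rightarrow> 'p set \<Rightarrow> 'p set"
  assumes fin: "finite P" and card_ge: "card P \<ge> 3"
    and circle: "C \<in> circs \<Longrightarrow> C \<subseteq> P \<and> card C = 10"
    and circle_ex: "x \<in> P \<Longrightarrow> x' \<in> P \<Longrightarrow> x'' \<in> P \<Longrightarrow> x \<noteq> x' \<Longrightarrow> x \<noteq> x'' \<Longrightarrow> x' \<noteq> x'' \<Longrightarrow>
      \<exists>C\<in>circs. x \<in> C \<and> x' \<in> C \<and> x'' \<in> C"
    and circle_unique: "C \<in> circs \<Longrightarrow> C' \<in> circs \<Longrightarrow> {x, x', x''} \<subseteq> C \<inter> C' \<Longrightarrow>
      x \<noteq> x' \<Longrightarrow> x \<noteq> x'' \<Longrightarrow> x' \<noteq> x'' \<Longrightarrow> C = C'"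
    and local_SQS: "C \<in> circs \<Longrightarrow> SQS 20 (C \<times> UNIV) (S C)"
    and local_pairs: "C \<in> circs \<Longrightarrow> x \<in> C \<Longrightarrow> z \<in> C \<Longrightarrow> x \<noteq> z \<Longrightarrow> fiber x \<union> fiber z \<in> S C"
    and partner: "x \<in> P \<Longrightarrow> y x \<in> P \<and> y x \<noteq> x"
    and par: "C \<in> circs \<Longrightarrow> x \<in> C \<Longrightarrow> y x \<notin> C \<Longrightarrow>
      par x C \<in> circs \<and> x \<in> par x C \<and> y x \<in> par x C \<and> C \<inter> par x C = {x}"
    and par_disjoint: "C \<in> circs \<Longrightarrow> C' \<in> circs \<Longrightarrow> x \<in> C \<Longrightarrow> x \<in> C' \<Longrightarrow> y x \<notin> C \<Longrightarrow> y x \<notin> C' \<Longrightarrow>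
      par x C = par x C' \<Longrightarrow> C \<noteq> C' \<Longrightarrow> C \<inter> C' = {x}"
    and resolvable: "C \<in> circs \<Longrightarrow> x \<in> C \<Longrightarrow> y x \<notin> C \<Longrightarrow> resolvable_at (S C) (x, i) (x, \<not> i)"
    and hanani: "C \<in> circs \<Longrightarrow> x \<in> C \<Longrightarrow> y x \<in> C \<Longrightarrow>
      hanani_at (S C) (x, i) (insert (x, \<not> i) (fiber (y x)))"
begin

section \<open>The glued quadruple system\<close>

definition blocks :: "('p \<times> bool) set set" where
  "blocks = (\<Union>C\<in>circs. S C)"

lemma local_block:
  assumes "C \<in> circs" "b \<in> S C"
  shows "b \<subseteq> C \<times> UNIV" "card b = 4"
  using local_SQS[OF assms(1)] assms(2) unfolding SQS_def by blast+

lemma local_unique: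
  assumes "C \<in> circs" "b \<in> S C" "b' \<in> S C" "t \<subseteq> b" "t \<subseteq> b'" "card t = 3"
  shows "b = b'"
  using SQS_unique[OF local_SQS[OF assms(1)]] assms(2-6) by blast

lemma circle_through_pair:
  assumes "x \<in> P" "z \<in> P" "x \<noteq> z"
  obtains C where "C \<in> circs" "x \<in> C" "z \<in> C"
proof -
  have "\<not> P \<subseteq> {x, z}"
    using card_ge card_mono[of "{x, z}" P] assms(3) by auto
  then obtain w where "w \<in> P" "w \<noteq> x" "w \<noteq> z" by blast
  thus ?thesis using circle_ex[of x z w] assms that by blast
qed

text \<open>Two points of a triple with the same first component fill a fibre, which leaves room for
  one more point. These are the two cases distinguished in \<open>SQS_blocks\<close>.\<close>

lemma card_fst_image:
  assumes "card t = 3" "finite (t :: ('p \<times> bool) set)"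
  shows "card (fst ` t) = 3 \<or> (\<exists>x z i. x \<noteq> z \<and> t = insert (z, i) (fiber x))"
proof (cases "inj_on fst t")
  case True
  thus ?thesis using card_image assms(1) by metis
next
  case False
  then obtain p q where pq: "p \<in> t" "q \<in> t" "p \<noteq> q" "fst p = fst q" by (auto simp: inj_on_def)
  define x where "x = fst p"
  have "{p, q} = fiber x"
    using pq by (cases p; cases q; cases "snd p") (auto simp: x_def)
  hence sub: "fiber x \<subseteq> t" using pq(1,2) by blast
  hence "card (t - fiber x) = 1" using assms by (simp add: card_Diff_subset)
  then obtain r where r: "t - fiber x = {r}" by (auto simp: card_1_singleton_iff)
  have "r \<notin> fiber x" using r by blast
  moreover obtain z i where "r = (z, i)" by (cases r)
  ultimately have "x \<noteq> z" by (cases i) auto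
  moreover have "t = insert (z, i) (fiber x)"
    using r sub \<open>r = (z, i)\<close> by blast
  ultimately show ?thesis by blast
qed

text \<open>Any circle carrying such a block contains \<open>x\<close> and \<open>z\<close>, so its
  local system also has the union of the two fibres, and a triple determines its block there. The
  answer is thus the same for all circles through \<open>x\<close> and \<open>z\<close>.\<close>

lemma unique_block_through_fiber:
  assumes "x \<in> P" "z \<in> P" "x \<noteq> z"
  shows "b \<in> blocks \<and> insert (z, i) (fiber x) \<subseteq> b \<longleftrightarrow> b = fiber x \<union> fiber z"
proof
  assume "b = fiber x \<union> fiber z"
  moreover obtain C where "C \<in> circs" "x \<in> C" "z \<in> C"
    using circle_through_pair[OF assms] .
  ultimately show "b \<in> blocks \<and> insert (z, i) (fiber x) \<subseteq> b"
    using local_pairs assms(3) unfolding blocks_def by (cases i) auto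
next
  assume b: "b \<in> blocks \<and> insert (z, i) (fiber x) \<subseteq> b"
  then obtain C where C: "C \<in> circs" "b \<in> S C" by (auto simp: blocks_def)
  have "x \<in> C" "z \<in> C" using local_block[OF C] b by auto
  hence "fiber x \<union> fiber z \<in> S C" using local_pairs C(1) assms(3) by blast
  moreover have "insert (z, i) (fiber x) \<subseteq> fiber x \<union> fiber z" by (cases i) auto
  moreover have "card (insert (z, i) (fiber x)) = 3" using assms(3) by simp
  ultimately show "b = fiber x \<union> fiber z"
    using local_unique[OF C] b by blast
qed

lemma SQS_blocks: "SQS (2 * card P) (P \<times> UNIV) blocks"
proof (rule SQSI)
  show "finite (P \<times> (UNIV :: bool set))" using fin by simp
  show "card (P \<times> (UNIV :: bool set)) = 2 * card P" by (simp add: card_cartesian_product)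
  show "b \<subseteq> P \<times> UNIV \<and> card b = 4" if "b \<in> blocks" for b
    using that local_block circle unfolding blocks_def by blast
  fix t :: "('p \<times> bool) set" assume t: "t \<subseteq> P \<times> UNIV" "card t = 3"
  have fint: "finite t" using t(2) by (intro card_ge_0_finite) simp
  consider "card (fst ` t) = 3" | x z i where "x \<noteq> z" "t = insert (z, i) (fiber x)"
    using card_fst_image[OF t(2) fint] by blast
  thus "\<exists>!b. b \<in> blocks \<and> t \<subseteq> b"
  proof cases
    case 1
    then obtain p q r where pqr: "fst ` t = {p, q, r}" "p \<noteq> q" "p \<noteq> r" "q \<noteq> r"
      by (auto simp: card_3_iff)
    have "fst ` t \<subseteq> P" using t(1) by auto
    hence "{p, q, r} \<subseteq> P" using pqr(1) by simp
    then obtain C where C: "C \<in> circs" "{p, q, r} \<subseteq> C"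
      using circle_ex[of p q r] pqr by auto
    have "t \<subseteq> C \<times> UNIV" using C(2) unfolding pqr(1)[symmetric] by force
    hence "\<exists>!b. b \<in> S C \<and> t \<subseteq> b"
      using local_SQS[OF C(1)] t(2) unfolding SQS_def by blast
    then obtain b where b: "b \<in> S C \<and> t \<subseteq> b"
      and uniq: "\<And>b'. b' \<in> S C \<and> t \<subseteq> b' \<Longrightarrow> b' = b"
      by (rule ex1_obtain) (rule that)
    show ?thesis
    proof (rule ex1I[of _ b])
      show "b \<in> blocks \<and> t \<subseteq> b" using b C(1) by (auto simp: blocks_def)
    next
      \<comment> \<open>Three different points of \<open>P\<close> lie on one circle only, so a
        competing block comes from the same local system.\<close>
      fix b' assume b': "b' \<in> blocks \<and> t \<subseteq> b'"
      then obtain C' where C': "C' \<in> circs" "b' \<in> S C'" by (auto simp: blocks_def)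
      have "fst ` t \<subseteq> C'" using local_block(1)[OF C'] b' by auto
      hence "C' = C" using circle_unique[OF C'(1) C(1), of p q r] C(2) pqr by simp
      thus "b' = b" using uniq b' C'(2) by blast
    qed
  next
    case 2
    hence "x \<in> P" "z \<in> P" using t(1) by auto
    thus ?thesis using unique_block_through_fiber[of x z _ i] 2(1) unfolding 2(2) by simp
  qed
qed

section \<open>Colouring the derived designs\<close>

lemma colorable_derived:
  assumes "x \<in> P"
  shows "colorable (card P) (P \<times> UNIV - {(x, i)}) (derived_blocks blocks (x, i))"
proof -
  define D where "D = derived_blocks blocks (x, i)"
  define Z where "Z = P - {x, y x}"
  have yx: "y x \<in> P" "y x \<noteq> x" using partner[OF assms] by auto
  \<comment> \<open>Each derived block is assigned a circle. A block containing
    \<open>(x, \<not> i)\<close> comes from a union of two fibres and may lie over several circles;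
    one through \<open>y x\<close> is taken.\<close>
  have "\<forall>d\<in>D. \<exists>C. C \<in> circs \<and> x \<in> C \<and> d \<in> derived_blocks (S C) (x, i) \<and>
      ((x, \<not> i) \<in> d \<longrightarrow> y x \<in> C)"
  proof
    fix d assume dD: "d \<in> D"
    obtain C b where C: "C \<in> circs" "b \<in> S C" "(x, i) \<in> b" "d = b - {(x, i)}"
      using dD unfolding D_def derived_blocks_def blocks_def by blast
    have xC: "x \<in> C" using local_block(1)[OF C(1,2)] C(3) by auto
    show "\<exists>C. C \<in> circs \<and> x \<in> C \<and> d \<in> derived_blocks (S C) (x, i) \<and> ((x, \<not> i) \<in> d \<longrightarrow> y x \<in> C)"
    proof (cases "(x, \<not> i) \<in> d")
      case False
      thus ?thesis using C xC by (auto simp: derived_blocks_def)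
    next
      case True
      hence sub: "fiber x \<subseteq> b" using C(3,4) by (auto simp: fiber_split[of x i])
      have "\<not> b \<subseteq> fiber x"
        using card_mono[of "fiber x" b] local_block(2)[OF C(1,2)] by auto
      then obtain z j where z: "(z, j) \<in> b" "(z, j) \<notin> fiber x" by auto
      hence "z \<noteq> x" by (cases j) auto
      have "z \<in> C" using local_block(1)[OF C(1,2)] z(1) by auto
      hence "z \<in> P" using circle C(1) by blast
      have "\<exists>C'\<in>circs. x \<in> C' \<and> z \<in> C' \<and> y x \<in> C'"
      proof (cases "z = y x")
        case True
        thus ?thesis using C(1) xC \<open>z \<in> C\<close> by blast
      next
        case False
        thus ?thesis
          using circle_ex[OF assms \<open>z \<in> P\<close> yx(1) \<open>z \<noteq> x\<close>[symmetric] yx(2)[symmetric]] by simp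
      qed
      then obtain C' where C': "C' \<in> circs" "x \<in> C'" "z \<in> C'" "y x \<in> C'" by blast
      have "b = fiber x \<union> fiber z"
        using unique_block_through_fiber[of x z b j] assms \<open>z \<in> P\<close> \<open>z \<noteq> x\<close> C sub z(1)
        by (auto simp: blocks_def)
      hence "b \<in> S C'" using local_pairs C' \<open>z \<noteq> x\<close> by blast
      hence "d \<in> derived_blocks (S C') (x, i)" using C(3,4) by (auto simp: derived_blocks_def)
      thus ?thesis using C' by blast
    qed
  qed
  from bchoice[OF this] obtain K where K': "\<forall>d\<in>D. K d \<in> circs \<and> x \<in> K d \<and> d \<in> derived_blocks (S (K d)) (x, i) \<and>
      ((x, \<not> i) \<in> d \<longrightarrow> y x \<in> K d)" ..
  have K: "K d \<in> circs" "x \<in> K d" "d \<in> derived_blocks (S (K d)) (x, i)" if "d \<in> D" for d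
    using K' that by auto
  have K_fiber: "y x \<in> K d" if "d \<in> D" "(x, \<not> i) \<in> d" for d
    using K' that by auto
  have dsub: "d \<subseteq> K d \<times> UNIV - {(x, i)}" if "d \<in> D" for d
    using K(3)[OF that] local_block(1)[OF K(1)[OF that]] by (auto simp: derived_blocks_def)
  have meets_fiber: "p = (x, \<not> i)" if "p \<in> d" "d \<in> D" "fst p = x" for p d
    using that dsub[OF that(2)] by (cases p; cases i; cases "snd p") auto
  \<comment> \<open>The good circles represent the parallel classes. \<open>g C\<close> numbers the
    eight points of \<open>C\<close> other than \<open>x\<close> and \<open>y x\<close>; they become
    the colours reserved for \<open>C\<close> and the lines parallel to it.\<close>
  define good where "good C \<longleftrightarrow> C \<in> circs \<and> x \<in> C \<and> y x \<in> C" for C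
  have "\<forall>C\<in>Collect good. \<exists>g :: nat \<Rightarrow> 'p. bij_betw g {..<8} (C - {x, y x})"
  proof
    fix C assume "C \<in> Collect good"
    hence C: "card C = 10" "x \<in> C" "y x \<in> C" "finite C"
      using circle fin finite_subset unfolding good_def by blast+
    have "card (C - {x, y x}) = 8" using C yx(2) by (subst card_Diff_subset) auto
    thus "\<exists>g :: nat \<Rightarrow> 'p. bij_betw g {..<8} (C - {x, y x})"
      using C(4) by (intro finite_same_card_bij) auto
  qed
  from bchoice[OF this] obtain g :: "'p set \<Rightarrow> nat \<Rightarrow> 'p"
    where g: "\<And>C. good C \<Longrightarrow> bij_betw (g C) {..<8} (C - {x, y x})"
    by auto
  have g_mem: "g C k \<in> C - {x, y x}" if "good C" "k < 8" for C k
    using bij_betwE[OF g[OF that(1)]] that(2) by auto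
  have g_inj: "k = l" if "good C" "k < 8" "l < 8" "g C k = g C l" for C k l
    using bij_betw_imp_inj_on[OF g[OF that(1)]] that by (auto simp: inj_on_def)
  \<comment> \<open>Distinct good circles share only \<open>x\<close> and \<open>y x\<close>, so a
    colour that is a point determines its good circle.\<close>
  have good_eq: "C = C'" if "good C" "good C'" "z \<in> C" "z \<in> C'" "z \<noteq> x" "z \<noteq> y x" for C C' z
    using circle_unique[of C C' x "y x" z] that yx(2) unfolding good_def by auto
  \<comment> \<open>\<open>s\<close> is what remains of the union of the fibres of \<open>x\<close>
    and \<open>y x\<close>, a block present over every good circle.\<close>
  define s where "s = insert (x, \<not> i) (fiber (y x))"
  have "\<forall>C\<in>Collect good. \<exists>c :: _ \<Rightarrow> nat. proper_coloring c (derived_blocks (S C) (x, i)) \<and>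
     (\<forall>d\<in>derived_blocks (S C) (x, i). c d < 10 \<and>
        (d \<inter> s \<noteq> {} \<longrightarrow> (if d = s then c d = 8 else c d < 8)))"
    using hanani[of _ x i] unfolding good_def hanani_at_def s_def by simp
  from bchoice[OF this] obtain h :: "'p set \<Rightarrow> _ \<Rightarrow> nat" where h':
    "\<forall>C\<in>Collect good. proper_coloring (h C) (derived_blocks (S C) (x, i)) \<and>
     (\<forall>d\<in>derived_blocks (S C) (x, i). h C d < 10 \<and>
        (d \<inter> s \<noteq> {} \<longrightarrow> (if d = s then h C d = 8 else h C d < 8)))" ..
  have h: "proper_coloring (h C) (derived_blocks (S C) (x, i))" if "good C" for C
    using h' that by simp
  have h_le: "h C d < 10" "d \<inter> s \<noteq> {} \<Longrightarrow> h C d \<ge> 8 \<Longrightarrow> d = s"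
    if "good C" "d \<in> derived_blocks (S C) (x, i)" for C d
  proof -
    have *: "h C d < 10 \<and> (d \<inter> s \<noteq> {} \<longrightarrow> (if d = s then h C d = 8 else h C d < 8))"
      using h' that by blast
    thus "h C d < 10" by simp
    show "d = s" if "d \<inter> s \<noteq> {}" "h C d \<ge> 8"
      using * that by (auto split: if_splits)
  qed
  define skew where "skew C \<longleftrightarrow> C \<in> circs \<and> x \<in> C \<and> y x \<notin> C" for C
  have "\<forall>C\<in>Collect skew. \<exists>c :: _ \<Rightarrow> nat.
     proper_coloring c {d \<in> derived_blocks (S C) (x, i). (x, \<not> i) \<notin> d} \<and>
     (\<forall>d\<in>derived_blocks (S C) (x, i). (x, \<not> i) \<notin> d \<longrightarrow> c d < 8)"
    using resolvable[of _ x i] unfolding skew_def resolvable_at_def by simp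
  from bchoice[OF this] obtain r :: "'p set \<Rightarrow> _ \<Rightarrow> nat" where r':
    "\<forall>C\<in>Collect skew. proper_coloring (r C) {d \<in> derived_blocks (S C) (x, i). (x, \<not> i) \<notin> d} \<and>
     (\<forall>d\<in>derived_blocks (S C) (x, i). (x, \<not> i) \<notin> d \<longrightarrow> r C d < 8)" ..
  have r: "proper_coloring (r C) {d \<in> derived_blocks (S C) (x, i). (x, \<not> i) \<notin> d}"
    if "skew C" for C
    using r' that by blast
  have r_le: "r C d < 8" if "skew C" "d \<in> derived_blocks (S C) (x, i)" "(x, \<not> i) \<notin> d" for C d
    using r' that by blast
  \<comment> \<open>\<open>Inl z\<close> is the colour given by the point \<open>z\<close>;
    \<open>Inr 8\<close> and \<open>Inr 9\<close> are the two colours common to all good circles.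
    The first eight local colours become points of the good circle in the same parallel
    class.\<close>
  define c where "c d = (if y x \<in> K d
      then (if h (K d) d < 8 then Inl (g (K d) (h (K d) d)) else Inr (h (K d) d))
      else Inl (g (par x (K d)) (r (K d) d)))" for d
  have skewK: "skew (K d)" if "d \<in> D" "y x \<notin> K d" for d
    using K that by (simp add: skew_def)
  have goodK: "good (K d)" if "d \<in> D" "y x \<in> K d" for d
    using K that by (simp add: good_def)
  have parK: "good (par x (K d))" "K d \<inter> par x (K d) = {x}" "(x, \<not> i) \<notin> d" "r (K d) d < 8"
    if "d \<in> D" "y x \<notin> K d" for d
  proof -
    show *: "(x, \<not> i) \<notin> d" using K_fiber that by blast
    show "good (par x (K d))" "K d \<inter> par x (K d) = {x}"
      using par[OF K(1,2) that(2)] that(1) by (simp_all add: good_def)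
    show "r (K d) d < 8" using r_le[OF skewK[OF that] K(3)[OF that(1)] *] .
  qed
  \<comment> \<open>Over circles that touch only at \<open>x\<close>, two derived blocks could meet
    only in \<open>(x, \<not> i)\<close>, since \<open>(x, i)\<close> has been removed.\<close>
  have disj_x: "d \<inter> d' = {}"
    if "d \<in> D" "d' \<in> D" "K d \<inter> K d' = {x}" "(x, \<not> i) \<notin> d'" for d d'
  proof (rule equals0I)
    fix p assume p: "p \<in> d \<inter> d'"
    hence "fst p \<in> K d \<inter> K d'" using dsub[OF that(1)] dsub[OF that(2)] by auto
    hence "fst p = x" using that(3) by simp
    thus False using meets_fiber[of p d'] that(2,4) p by simp
  qed
  \<comment> \<open>Equal colours force the good circle to be the parallel of the skew one, which it
    meets only in \<open>x\<close>.\<close>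
  have mixed: "d \<inter> d' = {}"
    if d: "d \<in> D" "d' \<in> D" "y x \<in> K d" "y x \<notin> K d'" and eq: "c d = c d'" for d d'
  proof -
    have lt: "h (K d) d < 8" and eq': "g (K d) (h (K d) d) = g (par x (K d')) (r (K d') d')"
      using eq d(3,4) by (auto simp: c_def split: if_splits)
    have "K d = par x (K d')"
      using good_eq[OF goodK[OF d(1,3)] parK(1)[OF d(2,4)], of "g (K d) (h (K d) d)"]
        g_mem[OF goodK[OF d(1,3)] lt] g_mem[OF parK(1)[OF d(2,4)] parK(4)[OF d(2,4)]] eq'
      by auto
    hence "K d \<inter> K d' = {x}" using parK(2)[OF d(2,4)] by (simp add: Int_commute)
    thus ?thesis using disj_x d(1,2) parK(3)[OF d(2,4)] by blast
  qed
  have "proper_coloring c D"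
    unfolding proper_coloring_def
  proof (intro ballI impI)
    fix d d' assume d: "d \<in> D" "d' \<in> D" and eq: "c d = c d'" and neq: "d \<noteq> d'"
    show "d \<inter> d' = {}"
    proof (cases "y x \<in> K d"; cases "y x \<in> K d'")
      assume y: "y x \<in> K d" "y x \<in> K d'"

      note good = goodK[OF d(1) y(1)] goodK[OF d(2) y(2)]
      have same: ?thesis if "K d = K d'" "h (K d) d = h (K d') d'"
        using h[OF good(1)] K(3)[OF d(1)] K(3)[OF d(2)] that neq
        unfolding proper_coloring_def by simp
      show ?thesis
      proof (cases "h (K d) d < 8")
        case True
        hence lt: "h (K d') d' < 8" and eq': "g (K d) (h (K d) d) = g (K d') (h (K d') d')"
          using eq y by (auto simp: c_def split: if_splits)
        have "K d = K d'"
          using good_eq[OF good, of "g (K d) (h (K d) d)"]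
            g_mem[OF good(1) True] g_mem[OF good(2) lt] eq' by auto
        thus ?thesis using same g_inj[OF good(1) True, of "h (K d') d'"] lt eq' by simp
      next
        case False
        hence heq: "h (K d) d = h (K d') d'" and ge: "h (K d') d' \<ge> 8"
          using eq y by (auto simp: c_def split: if_splits)
        show ?thesis
        proof (rule ccontr)
          assume "d \<inter> d' \<noteq> {}"
          then obtain p where p: "p \<in> d" "p \<in> d'" by blast
          have "fst p \<in> K d" "fst p \<in> K d'"
            using p dsub[OF d(1)] dsub[OF d(2)] by auto
          moreover have "K d \<noteq> K d'" using same heq p by blast
          \<comment> \<open>A common point of blocks over different good circles lies over
            \<open>x\<close> or \<open>y x\<close>, hence in \<open>s\<close>. Among the blocks
            meeting \<open>s\<close>, only \<open>s\<close> itself may have a colour from 8 on, so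
            both blocks equal \<open>s\<close>.\<close>
          ultimately have "fst p = x \<or> fst p = y x" using good_eq[OF good] by blast
          hence "p \<in> s"
            using meets_fiber[OF p(1) d(1)] by (cases p; cases "snd p") (auto simp: s_def)
          hence "d = s" "d' = s"
            using h_le(2)[OF good(1) K(3)[OF d(1)]] h_le(2)[OF good(2) K(3)[OF d(2)]] p False ge by auto
          thus False using neq by simp
        qed
      qed
    next
      assume "y x \<in> K d" "y x \<notin> K d'"
      thus ?thesis using mixed d eq by blast
    next
      assume "y x \<notin> K d" "y x \<in> K d'"
      thus ?thesis using mixed[of d' d] d eq by (metis Int_commute)
    next
      assume y: "y x \<notin> K d" "y x \<notin> K d'"
      have eq': "g (par x (K d)) (r (K d) d) = g (par x (K d')) (r (K d') d')"
        using eq y by (simp add: c_def)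
      \<comment> \<open>The colour, a point other than \<open>x\<close> and \<open>y x\<close>,
        identifies the parallel. Two skew circles with the same parallel are equal or meet only in
        \<open>x\<close>.\<close>
      have par_eq: "par x (K d) = par x (K d')"
        using good_eq[OF parK(1)[OF d(1) y(1)] parK(1)[OF d(2) y(2)], of "g (par x (K d)) (r (K d) d)"]
          g_mem[OF parK(1)[OF d(1) y(1)] parK(4)[OF d(1) y(1)]]
          g_mem[OF parK(1)[OF d(2) y(2)] parK(4)[OF d(2) y(2)]] eq'
        by auto
      show ?thesis
      proof (cases "K d = K d'")
        case True
        have "r (K d) d = r (K d') d'"
          using g_inj[OF parK(1)[OF d(1) y(1)]] parK(4)[OF d(1) y(1)] parK(4)[OF d(2) y(2)] eq' True
          by simp
        thus ?thesis
          using r[OF skewK[OF d(1) y(1)]] K(3)[OF d(1)] K(3)[OF d(2)]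
            parK(3)[OF d(1) y(1)] parK(3)[OF d(2) y(2)] True neq
          unfolding proper_coloring_def by simp
      next
        case False
        have "K d \<inter> K d' = {x}"
          by (rule par_disjoint) (use K d y par_eq False in auto)
        thus ?thesis using disj_x d parK(3)[OF d(2) y(2)] by blast
      qed
    qed
  qed
  moreover have "c ` D \<subseteq> Inl ` Z \<union> Inr ` {8, 9}"
  proof (rule image_subsetI)
    fix d assume d: "d \<in> D"
    have gZ: "g C k \<in> Z" if "good C" "k < 8" for C k
      using g_mem[OF that] that(1) circle unfolding good_def Z_def by blast
    show "c d \<in> Inl ` Z \<union> Inr ` {8, 9}"
    proof (cases "y x \<in> K d")
      case True
      have "h (K d) d < 10" using h_le(1)[OF goodK[OF d True] K(3)[OF d]] .
      thus ?thesis using gZ[OF goodK[OF d True]] True by (auto simp: c_def)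
    next
      case False
      thus ?thesis using gZ[OF parK(1)[OF d False] parK(4)[OF d False]] by (simp add: c_def)
    qed
  qed
  moreover have "d \<subseteq> P \<times> UNIV - {(x, i)}" if "d \<in> D" for d
    using dsub[OF that] circle[OF K(1)[OF that]] by blast
  \<comment> \<open>There are \<open>card P - 2\<close> points other than \<open>x\<close> and
    \<open>y x\<close>; the two common colours restore the total to \<open>card P\<close>.\<close>
  moreover have "card (Inl ` Z \<union> Inr ` {8 :: nat, 9}) \<le> card P"
  proof -
    have "card Z = card P - 2"
      unfolding Z_def using assms yx fin by (subst card_Diff_subset) auto
    hence "card (Inl ` Z :: ('p + nat) set) = card P - 2"
      by (simp add: card_image)
    moreover have "card (Inr ` {8, 9} :: ('p + nat) set) = 2"
      by (simp add: card_image)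
    ultimately show ?thesis
      using card_Un_le[of "Inl ` Z :: ('p + nat) set" "Inr ` {8, 9}"] card_ge by simp
  qed
  moreover have "finite (Inl ` Z \<union> Inr ` {8 :: nat, 9})" using fin by (simp add: Z_def)
  ultimately show ?thesis unfolding D_def by (intro colorableI)
qed


end

section \<open>Circles in the projective line\<close>

text \<open>Both fields are subsets of an ambient field. As \<open>inverse 0 = 0\<close>, closure
  under inverses can be asked of zero as well.\<close>

locale subfield_pair =
  fixes K F :: "'a :: field set"
  assumes finite_K: "finite K" and F_subset: "F \<subseteq> K" and card_F: "card F = 9"
    and K_closed: "\<And>a b. a \<in> K \<Longrightarrow> b \<in> K \<Longrightarrow> a + b \<in> K" "\<And>a b. a \<in> K \<Longrightarrow> b \<in> K \<Longrightarrow> a * b \<in> K"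
      "\<And>a. a \<in> K \<Longrightarrow> - a \<in> K" "\<And>a. a \<in> K \<Longrightarrow> inverse a \<in> K"
    and F_closed: "\<And>a b. a \<in> F \<Longrightarrow> b \<in> F \<Longrightarrow> a + b \<in> F" "\<And>a b. a \<in> F \<Longrightarrow> b \<in> F \<Longrightarrow> a * b \<in> F"
      "\<And>a. a \<in> F \<Longrightarrow> - a \<in> F" "\<And>a. a \<in> F \<Longrightarrow> inverse a \<in> F"
    and F_01: "0 \<in> F" "1 \<in> F"
begin

section \<open>Affine lines over \<open>F\<close> in \<open>K\<close>\<close>

lemma K_diff: "a \<in> K \<Longrightarrow> b \<in> K \<Longrightarrow> a - b \<in> K"
  using K_closed(1)[of a "- b"] K_closed(3)[of b] by simp

lemma F_diff: "a \<in> F \<Longrightarrow> b \<in> F \<Longrightarrow> a - b \<in> F"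
  using F_closed(1)[of a "- b"] F_closed(3)[of b] by simp

lemma K_01: "0 \<in> K" "1 \<in> K"
  using F_01 F_subset by auto

definition line :: "'a \<Rightarrow> 'a \<Rightarrow> 'a set" where
  "line u v = (\<lambda>s. u + s * v) ` F"

definition lines :: "'a set set" where
  "lines = {line u v | u v. u \<in> K \<and> v \<in> K \<and> v \<noteq> 0}"

lemma linesI: "u \<in> K \<Longrightarrow> v \<in> K \<Longrightarrow> v \<noteq> 0 \<Longrightarrow> line u v \<in> lines"
  unfolding lines_def by blast

lemma linesE:
  assumes "l \<in> lines"
  obtains u v where "u \<in> K" "v \<in> K" "v \<noteq> 0" "l = line u v"
  using assms unfolding lines_def by blast

lemma line_subset: "u \<in> K \<Longrightarrow> v \<in> K \<Longrightarrow> line u v \<subseteq> K"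
  using F_subset K_closed(1,2) by (auto simp: line_def)

lemma base_in_line: "u \<in> line u v"
  using F_01(1) by (force simp: line_def)

lemma line_rebase:
  assumes "w \<in> line u v"
  shows "line u v = line w v"
proof -
  obtain s where s: "s \<in> F" "w = u + s * v" using assms by (auto simp: line_def)
  have "u + t * v \<in> line w v" if "t \<in> F" for t
  proof -
    have "u + t * v = w + (t - s) * v" by (simp add: s(2) algebra_simps)
    thus ?thesis using F_diff[OF that s(1)] by (auto simp: line_def)
  qed
  moreover have "w + t * v \<in> line u v" if "t \<in> F" for t
  proof -
    have "w + t * v = u + (s + t) * v" by (simp add: s(2) algebra_simps)
    thus ?thesis using F_closed(1)[OF s(1) that] by (auto simp: line_def)
  qed
  ultimately show ?thesis by (auto simp: line_def)
qed

lemma line_scale: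
  assumes "c \<in> F" "c \<noteq> 0"
  shows "line u (c * v) = line u v"
proof -
  have "u + t * (c * v) \<in> line u v" if "t \<in> F" for t
    using F_closed(2)[OF that assms(1)] by (auto simp: line_def mult.assoc)
  moreover have "u + t * v \<in> line u (c * v)" if "t \<in> F" for t
  proof -
    have "u + t * v = u + (t * inverse c) * (c * v)" using assms(2) by simp
    thus ?thesis
      using F_closed(2)[OF that F_closed(4)[OF assms(1)]] unfolding line_def by (metis imageI)
  qed
  ultimately show ?thesis by (auto simp: line_def)
qed

text \<open>Rebasing at \<open>p\<close> shows that \<open>q - p\<close> is a nonzero
  \<open>F\<close>-multiple of \<open>v\<close>, and such a factor does not change the line.\<close>

lemma line_two_points:
  assumes "p \<in> line u v" "q \<in> line u v" "p \<noteq> q"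
  shows "line u v = line p (q - p)"
proof -
  have "q \<in> line p v" using assms(2) line_rebase[OF assms(1)] by simp
  then obtain c where c: "c \<in> F" "q = p + c * v" by (auto simp: line_def)
  hence "c \<noteq> 0" using assms(3) by auto
  thus ?thesis using line_scale[OF c(1), of p v] line_rebase[OF assms(1)] c(2) by simp
qed

lemma card_line: "v \<noteq> 0 \<Longrightarrow> card (line u v) = 9"
  unfolding line_def using card_F by (subst card_image) (auto simp: inj_on_def)

text \<open>Equality of directions passes from one base point to any other, because
  \<open>line w v\<close> is the translate of \<open>line p v\<close> by
  \<open>w - p\<close>.\<close>

lemma line_translate: "line p v = line p v' \<Longrightarrow> line w v = line w v'"
proof -
  have eq: "line w v = (\<lambda>t. t + (w - p)) ` line p v" for v
    by (auto simp: line_def image_image algebra_simps)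
  show "line p v = line p v' \<Longrightarrow> line w v = line w v'" using eq[of v] eq[of v'] by simp
qed

text \<open>The projective line over \<open>K\<close>, with \<open>None\<close> at infinity; \<open>chart x\<close> is a Moebius map taking
  infinity to \<open>x\<close>, so circles through \<open>x\<close> are the images of affine lines.\<close>

definition proj :: "'a option set" where
  "proj = insert None (Some ` K)"

definition chart :: "'a option \<Rightarrow> 'a \<Rightarrow> 'a option" where
  "chart x t = (case x of None \<Rightarrow> Some t | Some a \<Rightarrow> if t = 0 then None else Some (a + inverse t))"

definition circle_at :: "'a option \<Rightarrow> 'a set \<Rightarrow> 'a option set" where
  "circle_at x l = insert x (chart x ` l)"

definition circles :: "'a option set set" where
  "circles = {circle_at x l | x l. x \<in> proj \<and> l \<in> lines}"

section \<open>Charts and circles of the projective line\<close>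

lemma card_proj: "card proj = card K + 1"
  unfolding proj_def using finite_K by (simp add: card_image)

lemma finite_proj: "finite proj"
  unfolding proj_def using finite_K by simp

lemma chart_neq: "chart x t \<noteq> x"
  by (cases x) (auto simp: chart_def)

lemma chart_inj: "chart x t = chart x t' \<longleftrightarrow> t = t'"
  by (cases x) (auto simp: chart_def)

lemma chart_image:
  assumes "x \<in> proj"
  shows "chart x ` K = proj - {x}"
proof (cases x)
  case None
  thus ?thesis by (auto simp: chart_def proj_def)
next
  case (Some a)
  hence a: "a \<in> K" using assms by (auto simp: proj_def)
  have "chart x t \<in> proj - {x}" if "t \<in> K" for t
    using that Some a chart_neq[of x t] K_closed(1,4) by (auto simp: chart_def proj_def)
  moreover have "z \<in> chart x ` K" if z: "z \<in> proj - {x}" for z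
  proof (cases z)
    case None
    thus ?thesis using K_01(1) Some by (auto simp: chart_def image_iff intro!: bexI[of _ 0])
  next
    case (Some b)
    have b: "b \<in> K" "b \<noteq> a" using z Some \<open>x = Some a\<close> by (auto simp: proj_def)
    have "z = chart x (inverse (b - a))"
      using b(2) \<open>x = Some a\<close> Some by (simp add: chart_def)
    thus ?thesis using K_closed(4)[OF K_diff[OF b(1) a]] by blast
  qed
  ultimately show ?thesis by (intro equalityI subsetI) auto
qed

lemma chart_mem_circle: "chart x t \<in> circle_at x l \<longleftrightarrow> t \<in> l"
  using chart_neq[of x t] chart_inj[of x] by (auto simp: circle_at_def image_iff)

lemma circle_at_inj: "circle_at x l = circle_at x l' \<Longrightarrow> l = l'"
  using chart_mem_circle by blast

lemma circle_at_line: "circle_at x (line u v) = insert x ((\<lambda>s. chart x (u + s * v)) ` F)"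
  by (simp add: circle_at_def line_def image_image)

text \<open>\<open>f\<close> and \<open>g\<close> parametrize one circle by the projective line over
  \<open>F\<close>, matched by inverting the parameter. The point at infinity of the parameter line
  has the value \<open>x\<close> under \<open>f\<close> and \<open>x'\<close> under
  \<open>g\<close>, which is why these are inserted.\<close>

lemma circle_rebase_aux:
  assumes "f 0 = x'" "g 0 = x" "\<And>s. s \<in> F \<Longrightarrow> s \<noteq> 0 \<Longrightarrow> f (inverse s) = g s"
  shows "insert x (f ` F) = insert x' (g ` F)"
proof -
  have "f s \<in> insert x' (g ` F)" if "s \<in> F" for s
  proof (cases "s = 0")
    case False
    hence "f s = g (inverse s)" using assms(3)[OF F_closed(4)[OF that]] by simp
    thus ?thesis using F_closed(4)[OF that] by blast
  qed (simp add: assms(1))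
  moreover have "g s \<in> insert x (f ` F)" if "s \<in> F" for s
  proof (cases "s = 0")
    case False
    hence "g s = f (inverse s)" using assms(3)[OF that] by simp
    thus ?thesis using F_closed(4)[OF that] by blast
  qed (simp add: assms(2))
  moreover have "x \<in> g ` F" "x' \<in> f ` F" using assms(1,2) F_01(1) by auto
  ultimately show ?thesis by blast
qed

text \<open>The transition from the chart at \<open>x\<close> to the chart at \<open>x'\<close> is a
  Moebius map. Once the parameter of the line is inverted, it gives an affine expression again, so
  \<open>x'\<close> may serve as the centre.\<close>

lemma circle_change_centre:
  assumes x: "x \<in> proj" and l: "l \<in> lines" and x': "x' \<in> circle_at x l"
  shows "\<exists>l'\<in>lines. circle_at x l = circle_at x' l'"
proof (cases "x' = x")
  case True
  thus ?thesis using l by blast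
next
  case False
  then obtain u where u: "u \<in> l" "x' = chart x u" using x' by (auto simp: circle_at_def)
  obtain u0 v where v: "u0 \<in> K" "v \<in> K" "v \<noteq> 0" "l = line u0 v" using linesE[OF l] .
  have uK: "u \<in> K" using u(1) v line_subset by blast
  have l_eq: "l = line u v" using line_rebase u(1) v(4) by simp
  \<comment> \<open>Solving \<open>chart x (u + inverse s * v) = chart x' w\<close> for
    \<open>w\<close> gives \<open>s * inverse v\<close> when \<open>x\<close> is infinite,
    \<open>a + s * inverse v\<close> when \<open>x'\<close> is, and
    \<open>- u - s * (u * u) * inverse v\<close> when both are finite.\<close>
  have "\<exists>u'\<in>K. \<exists>v'\<in>K. v' \<noteq> 0 \<and> chart x' u' = x \<and>
      (\<forall>s. s \<noteq> 0 \<longrightarrow> chart x (u + inverse s * v) = chart x' (u' + s * v'))"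
  proof (cases x)
    case None
    have "x' = Some u" using u(2) None by (simp add: chart_def)
    thus ?thesis using None v K_01(1) K_closed(4)[OF v(2)]
      by (intro bexI[of _ 0] bexI[of _ "inverse v"]) (auto simp: chart_def)
  next
    case (Some a)
    hence aK: "a \<in> K" using x by (auto simp: proj_def)
    show ?thesis
    proof (cases "u = 0")
      case True
      have "x' = None" using u(2) Some True by (simp add: chart_def)
      thus ?thesis using Some True v aK K_closed(4)[OF v(2)]
        by (intro bexI[of _ a] bexI[of _ "inverse v"]) (auto simp: chart_def)
    next
      case u0: False
      have x'_eq: "x' = Some (a + inverse u)" using u(2) Some u0 by (simp add: chart_def)
      have key: "chart x (u + inverse s * v) = chart x' (- u + s * (- (u * u) * inverse v))"
        if "s \<noteq> 0" for s
      proof -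
        \<comment> \<open>\<open>D\<close> is a common factor of both chart arguments; where it
          vanishes, both sides are the point at infinity.\<close>
        define D where "D = v + s * u"
        have den: "u + inverse s * v = inverse s * D"
        proof -
          have "inverse s * (s * u) = u" using that by (simp flip: mult.assoc)
          thus ?thesis unfolding D_def distrib_left by (simp only: add.commute)
        qed
        have den': "- u + s * (- (u * u) * inverse v) = - (u * inverse v * D)"
        proof -
          have 1: "u * inverse v * v = u" using v(3) by (simp add: mult.assoc)
          have 2: "u * inverse v * (s * u) = s * (u * u * inverse v)" by (simp only: mult_ac)
          show ?thesis unfolding D_def distrib_left 1 2 by simp
        qed
        show ?thesis
        proof (cases "D = 0")
          case True
          show ?thesis unfolding den den' Some x'_eq chart_def True by simp
        next
          case nz: False
          have "inverse u - inverse u * v * inverse D = inverse u * (D - v) * inverse D"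
          proof -
            have "inverse u * D * inverse D = inverse u" using nz by (simp add: mult.assoc)
            thus ?thesis by (simp only: right_diff_distrib left_diff_distrib)
          qed
          also have "inverse u * (D - v) = s"
          proof -
            have "D - v = s * u" by (simp add: D_def)
            hence "inverse u * (D - v) = s * (inverse u * u)" by (simp only: mult_ac)
            thus ?thesis using u0 by simp
          qed
          finally have e1: "inverse u - inverse u * v * inverse D = s * inverse D" .
          have e2: "inverse (inverse s * D) = s * inverse D"
            by (simp only: inverse_mult_distrib inverse_inverse_eq)
          have e3: "inverse (- (u * inverse v * D)) = - (inverse u * v * inverse D)"
            by (simp only: inverse_minus_eq inverse_mult_distrib inverse_inverse_eq)
          have e: "a + inverse (inverse s * D) = a + inverse u + inverse (- (u * inverse v * D))"
            unfolding e2 e3 e1[symmetric] by (simp only: add_uminus_conv_diff add_diff_eq)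
          have "inverse s * D \<noteq> 0" "- (u * inverse v * D) \<noteq> 0"
            using nz that u0 v(3) by simp_all
          thus ?thesis using e
            unfolding den den' Some x'_eq chart_def by (simp only: option.case if_False)
        qed
      qed
      have "- u \<in> K" "- (u * u) * inverse v \<in> K" "- (u * u) * inverse v \<noteq> 0"
        using uK v(2,3) u0 K_closed by auto
      moreover have "chart x' (- u) = x" using u0 Some x'_eq by (simp add: chart_def)
      ultimately show ?thesis using key by blast
    qed
  qed
  then obtain u' v' where uv: "u' \<in> K" "v' \<in> K" "v' \<noteq> 0" "chart x' u' = x"
    "\<And>s. s \<noteq> 0 \<Longrightarrow> chart x (u + inverse s * v) = chart x' (u' + s * v')" by blast
  have "circle_at x l = circle_at x' (line u' v')"
    unfolding l_eq circle_at_line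
    by (rule circle_rebase_aux) (use u(2) uv in auto)
  thus ?thesis using linesI[OF uv(1-3)] by blast
qed

lemma circleE:
  assumes "C \<in> circles" "x \<in> C"
  obtains l where "l \<in> lines" "C = circle_at x l"
  using assms circle_change_centre unfolding circles_def by blast

lemma circle_at_subset:
  assumes "x \<in> proj" "l \<in> lines"
  shows "circle_at x l \<subseteq> proj"
proof -
  have "l \<subseteq> K" using linesE[OF assms(2)] line_subset by metis
  hence "chart x ` l \<subseteq> proj - {x}" using chart_image[OF assms(1)] by blast
  thus ?thesis using assms(1) by (auto simp: circle_at_def)
qed

lemma circle_card:
  assumes "C \<in> circles"
  shows "C \<subseteq> proj \<and> card C = 10"
proof -
  obtain x l where xl: "x \<in> proj" "l \<in> lines" "C = circle_at x l"
    using assms unfolding circles_def by blast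
  have "card l = 9" using linesE[OF xl(2)] card_line by metis
  moreover have "card (chart x ` l) = card l"
    using chart_inj by (intro card_image) (auto simp: inj_on_def)
  moreover have "x \<notin> chart x ` l" using chart_neq by (metis imageE)
  moreover have "finite l" using \<open>card l = 9\<close> by (intro card_ge_0_finite) simp
  ultimately have "card C = 10" by (simp add: xl(3) circle_at_def)
  thus ?thesis using circle_at_subset xl by simp
qed

lemma chartE:
  assumes "x \<in> proj" "z \<in> proj" "z \<noteq> x"
  obtains t where "t \<in> K" "z = chart x t"
  using chart_image[OF assms(1)] assms(2,3) by blast

text \<open>In the chart at \<open>x\<close>, the required circle is the line joining the
  coordinates of the other two points.\<close>

lemma circle_through:
  assumes "x \<in> proj" "x' \<in> proj" "x'' \<in> proj" "x \<noteq> x'" "x \<noteq> x''" "x' \<noteq> x''"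
  shows "\<exists>C\<in>circles. x \<in> C \<and> x' \<in> C \<and> x'' \<in> C"
proof -
  obtain p where p: "p \<in> K" "x' = chart x p" using chartE[OF assms(1,2) assms(4)[symmetric]] .
  obtain q where q: "q \<in> K" "x'' = chart x q" using chartE[OF assms(1,3) assms(5)[symmetric]] .
  have "p \<noteq> q" using p(2) q(2) assms(6) by blast
  hence "line p (q - p) \<in> lines" by (intro linesI p(1) K_diff q(1)) simp
  moreover have "p \<in> line p (q - p)" by (rule base_in_line)
  moreover have "q \<in> line p (q - p)"
    unfolding line_def by (rule image_eqI[of _ _ 1]) (simp_all add: F_01)
  ultimately have "circle_at x (line p (q - p)) \<in> circles"
    "x' \<in> circle_at x (line p (q - p))" "x'' \<in> circle_at x (line p (q - p))"
    using assms(1) p(2) q(2) chart_mem_circle unfolding circles_def by blast+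
  moreover have "x \<in> circle_at x (line p (q - p))" by (simp add: circle_at_def)
  ultimately show ?thesis by blast
qed

text \<open>Both circles can be centred at \<open>x\<close>, where the claim becomes uniqueness of
  the affine line through two points.\<close>

lemma circle_unique:
  assumes "C \<in> circles" "C' \<in> circles" "{x, x', x''} \<subseteq> C \<inter> C'"
    "x \<noteq> x'" "x \<noteq> x''" "x' \<noteq> x''"
  shows "C = C'"
proof -
  obtain l where l: "l \<in> lines" "C = circle_at x l" using circleE[OF assms(1), of x] assms(3) by auto
  obtain l' where l': "l' \<in> lines" "C' = circle_at x l'" using circleE[OF assms(2), of x] assms(3) by auto
  have x: "x \<in> proj" "x' \<in> proj" "x'' \<in> proj" using circle_card[OF assms(1)] assms(3) by auto
  obtain p where p: "p \<in> K" "x' = chart x p" using chartE[OF x(1,2) assms(4)[symmetric]] .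
  obtain q where q: "q \<in> K" "x'' = chart x q" using chartE[OF x(1,3) assms(5)[symmetric]] .
  have "p \<noteq> q" using p(2) q(2) assms(6) by blast
  moreover have "p \<in> l" "q \<in> l" "p \<in> l'" "q \<in> l'"
    using assms(3) p(2) q(2) l(2) l'(2) chart_mem_circle by auto
  ultimately have "l = line p (q - p)" "l' = line p (q - p)"
    using line_two_points[of p _ _ q] linesE[OF l(1)] linesE[OF l'(1)] by metis+
  thus ?thesis using l l' by simp
qed

section \<open>Partners and parallel circles\<close>

definition partner :: "'a option \<Rightarrow> 'a option" where
  "partner x = (case x of None \<Rightarrow> Some 0 | Some a \<Rightarrow> None)"

text \<open>For a circle \<open>C\<close> through \<open>x\<close>, the differences
  \<open>s - t\<close> form the direction of its line in the chart at \<open>x\<close>, and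
  \<open>p\<close> is the coordinate of the partner. In this form no base point or direction vector
  has to be chosen.\<close>

definition parallel :: "'a option \<Rightarrow> 'a option set \<Rightarrow> 'a option set" where
  "parallel x C = circle_at x
     {p + (s - t) | p s t. chart x p = partner x \<and> chart x s \<in> C \<and> chart x t \<in> C}"

lemma partner: "x \<in> proj \<Longrightarrow> partner x \<in> proj \<and> partner x \<noteq> x"
  using K_01 by (cases x) (auto simp: partner_def proj_def)

lemma parallel_eq:
  assumes "chart x p = partner x"
  shows "parallel x (circle_at x (line u v)) = circle_at x (line p v)"
proof -
  have "{p' + (s - t) | p' s t. chart x p' = partner x \<and>
      chart x s \<in> circle_at x (line u v) \<and> chart x t \<in> circle_at x (line u v)} =
      {p + (s - t) | s t. s \<in> line u v \<and> t \<in> line u v}"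
    unfolding chart_mem_circle assms[symmetric] chart_inj by auto
  also have "\<dots> = line p v"
  proof (intro equalityI subsetI)
    fix w assume "w \<in> {p + (s - t) | s t. s \<in> line u v \<and> t \<in> line u v}"
    then obtain s t where "s \<in> F" "t \<in> F" "w = p + ((u + s * v) - (u + t * v))"
      by (auto simp: line_def)
    hence "w = p + (s - t) * v" "s - t \<in> F" using F_diff by (auto simp: algebra_simps)
    thus "w \<in> line p v" by (auto simp: line_def)
  next
    fix w assume "w \<in> line p v"
    then obtain s where s: "s \<in> F" "w = p + s * v" by (auto simp: line_def)
    have "w = p + ((u + s * v) - u)" using s(2) by simp
    moreover have "u + s * v \<in> line u v" using s(1) by (auto simp: line_def)
    ultimately show "w \<in> {p + (s - t) | s t. s \<in> line u v \<and> t \<in> line u v}"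
      using base_in_line by blast
  qed
  finally show ?thesis by (simp add: parallel_def)
qed

text \<open>In the chart at \<open>x\<close>, the two circles are lines of the same direction. Only
  the second contains the partner, so the lines are different and hence disjoint.\<close>

lemma parallel:
  assumes "C \<in> circles" "x \<in> C" "partner x \<notin> C"
  shows "parallel x C \<in> circles \<and> x \<in> parallel x C \<and> partner x \<in> parallel x C \<and>
    C \<inter> parallel x C = {x}"
proof -
  have x: "x \<in> proj" using assms circle_card by blast
  obtain l where l: "l \<in> lines" "C = circle_at x l" using circleE[OF assms(1,2)] .
  obtain u v where uv: "u \<in> K" "v \<in> K" "v \<noteq> 0" "l = line u v" using linesE[OF l(1)] .
  obtain p where p: "p \<in> K" "partner x = chart x p" using chartE[OF x] partner[OF x] by blast
  have eq: "parallel x C = circle_at x (line p v)"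
    using parallel_eq p(2) l(2) uv(4) by simp
  have "p \<notin> line u v" using assms(3) l(2) uv(4) p(2) chart_mem_circle by simp
  have disj: "line u v \<inter> line p v = {}"
  proof (rule equals0I)
    fix w assume "w \<in> line u v \<inter> line p v"
    hence "line u v = line p v" using line_rebase by blast
    thus False using \<open>p \<notin> line u v\<close> base_in_line by blast
  qed
  have "z = x" if "z \<in> C" "z \<in> parallel x C" for z
  proof (rule ccontr)
    assume "z \<noteq> x"
    moreover have "z \<in> proj" using that(1) circle_card[OF assms(1)] by blast
    ultimately obtain t where t: "z = chart x t" using chartE[OF x] by blast
    have "t \<in> line u v" using that(1) unfolding t l(2) uv(4) chart_mem_circle .
    moreover have "t \<in> line p v" using that(2) unfolding t eq chart_mem_circle .
    ultimately show False using disj by blast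
  qed
  moreover have "x \<in> parallel x C" unfolding eq by (simp add: circle_at_def)
  moreover have "partner x \<in> parallel x C"
    unfolding eq p(2) chart_mem_circle by (rule base_in_line)
  moreover have "parallel x C \<in> circles" 
    unfolding eq circles_def using x linesI[OF p(1) uv(2,3)] by blast
  ultimately show ?thesis using assms(2) by blast
qed

text \<open>Circles with the same parallel have the same direction in the chart at \<open>x\<close>,
  and lines of one direction with a common point coincide.\<close>

lemma parallel_disjoint:
  assumes C: "C \<in> circles" "C' \<in> circles" "x \<in> C" "x \<in> C'" "parallel x C = parallel x C'" "C \<noteq> C'"
  shows "C \<inter> C' = {x}"
proof -
  have x: "x \<in> proj" using C circle_card by blast
  obtain p where "p \<in> K" "partner x = chart x p" using chartE[OF x] partner[OF x] by blast
  note p = this(2)[symmetric]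
  obtain l where l: "l \<in> lines" "C = circle_at x l" using circleE[OF C(1,3)] .
  obtain u v where uv: "l = line u v" using linesE[OF l(1)] .
  obtain l' where l': "l' \<in> lines" "C' = circle_at x l'" using circleE[OF C(2,4)] .
  obtain u' v' where uv': "l' = line u' v'" using linesE[OF l'(1)] .
  have "circle_at x (line p v) = circle_at x (line p v')"
    using C(5) unfolding l(2) l'(2) uv uv' parallel_eq[OF p] .
  hence dir: "line p v = line p v'" by (rule circle_at_inj)
  have "z = x" if "z \<in> C" "z \<in> C'" for z
  proof (rule ccontr)
    assume "z \<noteq> x"
    moreover have "z \<in> proj" using that(1) circle_card[OF C(1)] by blast
    ultimately obtain t where t: "z = chart x t" using chartE[OF x] by blast
    have "t \<in> line u v" using that(1) unfolding t l(2) uv chart_mem_circle .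
    moreover have "t \<in> line u' v'" using that(2) unfolding t l'(2) uv' chart_mem_circle .
    ultimately have "l = l'" using line_rebase line_translate[OF dir] unfolding uv uv' by metis
    thus False using C(6) l(2) l'(2) by simp
  qed
  thus ?thesis using C(3,4) by blast
qed

end

section \<open>Finite fields of characteristic 3\<close>

text \<open>A concrete field of order 3; its algebraic closure contains all the finite fields used
  below.\<close>

datatype f3 = Zero3 | One3 | Two3

instantiation f3 :: field
begin

definition zero_f3 :: f3 where "0 = Zero3"
definition one_f3 :: f3 where "1 = One3"
definition plus_f3 :: "f3 \<Rightarrow> f3 \<Rightarrow> f3" where
  "a + b = (case a of Zero3 \<Rightarrow> b
     | One3 \<Rightarrow> (case b of Zero3 \<Rightarrow> One3 | One3 \<Rightarrow> Two3 | Two3 \<Rightarrow> Zero3)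
     | Two3 \<Rightarrow> (case b of Zero3 \<Rightarrow> Two3 | One3 \<Rightarrow> Zero3 | Two3 \<Rightarrow> One3))"
definition uminus_f3 :: "f3 \<Rightarrow> f3" where
  "- a = (case a of Zero3 \<Rightarrow> Zero3 | One3 \<Rightarrow> Two3 | Two3 \<Rightarrow> One3)"
definition minus_f3 :: "f3 \<Rightarrow> f3 \<Rightarrow> f3" where "a - b = a + (- b :: f3)"
definition times_f3 :: "f3 \<Rightarrow> f3 \<Rightarrow> f3" where
  "a * b = (case a of Zero3 \<Rightarrow> Zero3 | One3 \<Rightarrow> b | Two3 \<Rightarrow> - b)"
text \<open>Each nonzero element of the field of order 3 is its own inverse, so division is
  multiplication.\<close>

definition inverse_f3 :: "f3 \<Rightarrow> f3" where "inverse a = (a :: f3)"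
definition divide_f3 :: "f3 \<Rightarrow> f3 \<Rightarrow> f3" where "a div b = a * (b :: f3)"

instance
proof
  fix a b c :: f3
  show "a * b * c = a * (b * c)" "(a + b) * c = a * c + b * c" "a + b + c = a + (b + c)"
    by (cases a; cases b; cases c; simp add: times_f3_def plus_f3_def uminus_f3_def)+
  show "a * b = b * a" "a + b = b + a" "a - b = a + - b" "a div b = a * inverse b"
    by (cases a; cases b; simp add: times_f3_def plus_f3_def uminus_f3_def minus_f3_def
          divide_f3_def inverse_f3_def)+
  show "1 * a = a" "0 + a = a" "- a + a = 0" "inverse (0 :: f3) = 0" "(0 :: f3) \<noteq> 1"
    by (cases a; simp add: times_f3_def plus_f3_def uminus_f3_def one_f3_def zero_f3_def
          inverse_f3_def)+
  show "inverse a * a = 1" if "a \<noteq> 0"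
    using that by (cases a) (simp_all add: times_f3_def uminus_f3_def one_f3_def zero_f3_def
        inverse_f3_def)
qed

end

section \<open>Fixed fields of powers of the Frobenius map\<close>

lemma CHAR_f3: "CHAR(f3) = 3"
proof -
  have "of_nat 3 = (0 :: f3)"
    by (simp add: numeral_3_eq_3 plus_f3_def one_f3_def zero_f3_def)
  hence "CHAR(f3) dvd 3" by (simp only: of_nat_eq_0_iff_char_dvd)
  moreover have "prime (3 :: nat)" by simp
  ultimately show ?thesis
    using CHAR_not_1[where ?'a = f3] by (auto simp: prime_nat_iff)
qed

text \<open>For \<open>q = 3 ^ m\<close> with \<open>m > 0\<close>, this is the subfield of order
  \<open>q\<close> of the algebraic closure.\<close>

definition frobenius_fixed :: "nat \<Rightarrow> f3 alg_closure set" where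
  "frobenius_fixed q = {x. x ^ q = x}"

text \<open>The elements are the roots of \<open>x ^ q - x\<close>, which splits over the algebraic
  closure and, in characteristic 3, has the derivative \<open>- 1\<close>. Hence all
  \<open>q\<close> roots are simple.\<close>

lemma card_frobenius_fixed:
  assumes "m > 0"
  shows "card (frobenius_fixed (3 ^ m)) = 3 ^ m"
proof -
  define q where "q = (3 :: nat) ^ m"
  have q: "q > 1" "3 dvd q" 
    using assms one_less_power[of "3 :: nat" m] by (simp_all add: q_def dvd_power)
  define p :: "f3 alg_closure poly" where "p = monom 1 q + (- monom 1 1)"
  have deg: "degree p = q"
    unfolding p_def using q(1) by (subst degree_add_eq_left) (simp_all add: degree_monom_eq)
  have "of_nat q = (0 :: f3 alg_closure)"
    using q(2) by (simp add: of_nat_eq_0_iff_char_dvd CHAR_f3)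
  hence pd: "pderiv p = - 1"
    by (simp add: p_def pderiv_add pderiv_diff pderiv_minus pderiv_monom monom_0 one_pCons)
  have "p \<noteq> 0" using deg q(1) by auto
  then obtain A c where A: "size A = degree p" "p = smult c (\<Prod>x\<in>#A. [:-x, 1:])" "c \<noteq> 0"
    using alg_closed_imp_factorization[of p] by (metis leading_coeff_0_iff)
  have roots: "poly p x = 0 \<longleftrightarrow> x \<in># A" for x
  proof -
    have "poly p x = c * (\<Prod>a\<in>#A. x - a)"
      unfolding A(2) by (simp add: poly_prod_mset image_mset.compositionality o_def)
    moreover have "(\<Prod>a\<in>#A. x - a) = 0 \<longleftrightarrow> x \<in># A"
      unfolding prod_mset_zero_iff by (metis eq_iff_diff_eq_0 in_image_mset imageE imageI)
    ultimately show ?thesis using A(3) by simp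
  qed
  have "count A x = 1" if x: "x \<in># A" for x
  proof (rule ccontr)
    assume "count A x \<noteq> 1"
    obtain C where C: "A = add_mset x C" using multi_member_split[OF x] by blast
    hence "x \<in># C" using \<open>count A x \<noteq> 1\<close> by (simp add: not_in_iff)
    then obtain B where "C = add_mset x B" using multi_member_split by metis
    hence B: "A = add_mset x (add_mset x B)" using C by simp
    define r where "r = smult c (\<Prod>a\<in>#B. [:-a, 1:])"
    \<comment> \<open>A repeated root would also be a root of the derivative.\<close>
    have "p = [:-x, 1:] * ([:-x, 1:] * r)"
      unfolding A(2) B r_def by (simp only: image_mset_add_mset prod_mset.add_mset mult_smult_right)
    hence "poly (pderiv p) x = 0"
      by (simp only: pderiv_mult poly_add poly_mult) simp
    thus False using pd by simp
  qed
  hence "card (set_mset A) = size A"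
    by (simp add: size_multiset_overloaded_eq)
  moreover have "frobenius_fixed q = set_mset A"
    using roots by (auto simp: frobenius_fixed_def p_def poly_monom)
  ultimately show ?thesis using A(1) deg by (simp add: q_def)
qed

lemma frobenius_fixed_closed:
  fixes m :: nat
  defines "K \<equiv> frobenius_fixed (3 ^ m)"
  shows "a \<in> K \<Longrightarrow> b \<in> K \<Longrightarrow> a + b \<in> K" "a \<in> K \<Longrightarrow> b \<in> K \<Longrightarrow> a * b \<in> K"
    "a \<in> K \<Longrightarrow> - a \<in> K" "a \<in> K \<Longrightarrow> inverse a \<in> K" "0 \<in> K" "1 \<in> K"
proof -
  show "a + b \<in> K" if "a \<in> K" "b \<in> K"
    using that freshmans_dream'[of "3 ^ m" m a b]
    by (simp add: K_def frobenius_fixed_def CHAR_f3)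
  show "- a \<in> K" if "a \<in> K"
    using that by (simp add: K_def frobenius_fixed_def power_minus_odd)
qed (simp_all add: K_def frobenius_fixed_def power_mult_distrib power_inverse)

lemma subfield_pair_frobenius_fixed:
  assumes "n \<ge> 1"
  shows "subfield_pair (frobenius_fixed (9 ^ n)) (frobenius_fixed 9)"
proof -
  have nine: "(9 :: nat) ^ n = 3 ^ (2 * n)" "(9 :: nat) = 3 ^ 2"
    by (simp_all add: power_mult)
  \<comment> \<open>What the ninth power fixes is fixed by its iterates, which embeds the smaller
    field in the larger one.\<close>
  have "x ^ (9 ^ n) = x" if "x ^ 9 = x" for x :: "f3 alg_closure"
    using that by (induction n) (simp_all add: power_mult)
  hence sub: "frobenius_fixed 9 \<subseteq> frobenius_fixed (9 ^ n)"
    by (auto simp: frobenius_fixed_def)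
  have card: "card (frobenius_fixed (9 ^ n)) = 9 ^ n" "card (frobenius_fixed 9) = 9"
    using card_frobenius_fixed[of "2 * n"] card_frobenius_fixed[of 2] assms by (simp_all add: nine(1))
  show ?thesis
  proof
    show "finite (frobenius_fixed (9 ^ n))"
      using card(1) by (intro card_ge_0_finite) simp
  qed (use sub card frobenius_fixed_closed[where m = "2 * n"] frobenius_fixed_closed[where m = 2]
      in \<open>simp_all add: nine(1)\<close>)
qed

section \<open>Designs on twenty points\<close>

text \<open>The two copies of a circle, with index 9 for \<open>\<infinity>\<close> and index 0 for \<open>0\<close> if these lie on it.\<close>

datatype pt = A0 | A1 | A2 | A3 | A4 | A5 | A6 | A7 | A8 | A9
  | B0 | B1 | B2 | B3 | B4 | B5 | B6 | B7 | B8 | B9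

fun flip :: "pt \<Rightarrow> pt" where
  "flip A0 = B0" | "flip A1 = B1" | "flip A2 = B2" | "flip A3 = B3" | "flip A4 = B4"
| "flip A5 = B5" | "flip A6 = B6" | "flip A7 = B7" | "flip A8 = B8" | "flip A9 = B9"
| "flip B0 = A0" | "flip B1 = A1" | "flip B2 = A2" | "flip B3 = A3" | "flip B4 = A4"
| "flip B5 = A5" | "flip B6 = A6" | "flip B7 = A7" | "flip B8 = A8" | "flip B9 = A9"

definition points :: "pt list" where
  "points = [A0, A1, A2, A3, A4, A5, A6, A7, A8, A9, B0, B1, B2, B3, B4, B5, B6, B7, B8, B9]"

definition through :: "pt \<Rightarrow> pt list list \<Rightarrow> pt list list" where
  "through p Q = map (remove1 p) (filter (\<lambda>b. p \<in> set b) Q)"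

definition quads_check :: "pt list list \<Rightarrow> bool" where
  "quads_check Q \<longleftrightarrow> list_all (\<lambda>b. length b = 4 \<and> distinct b) Q"

text \<open>If the blocks through \<open>p\<close> and \<open>q\<close> list 18 distinct points
  besides \<open>p\<close> and \<open>q\<close>, every third point occurs exactly once. The last
  condition looks for the union of the fibres of \<open>p\<close> and \<open>q\<close>.\<close>

definition point_check :: "pt list list \<Rightarrow> pt \<Rightarrow> bool" where
  "point_check Q p \<longleftrightarrow> (let D = through p Q in
     list_all (\<lambda>q. q = p \<or> (let L = concat (through q D) in length L = 18 \<and> distinct L) \<and>
       (q = flip p \<or> list_ex (\<lambda>d. flip p \<in> set d \<and> q \<in> set d \<and> flip q \<in> set d) D)) points)"

text \<open>\<open>cs\<close> colours the list \<open>D\<close> position by position with colours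
  from \<open>ks\<close>. Distinctness of a concatenated class makes its blocks pairwise
  disjoint.\<close>

definition classes_check :: "pt list list \<Rightarrow> nat list \<Rightarrow> nat list \<Rightarrow> bool" where
  "classes_check D cs ks \<longleftrightarrow> length cs = length D \<and> list_all (\<lambda>k. List.member ks k) cs \<and>
     list_all (\<lambda>k. distinct (concat (map fst (filter (\<lambda>z. snd z = k) (zip D cs))))) ks"

text \<open>\<open>r\<close> is a point over the partner of the point under \<open>p\<close>, so
  \<open>s\<close> is the derived block in whose terms \<open>hanani_at\<close> is stated. For
  blocks of three points, containing \<open>s\<close> amounts to being \<open>s\<close>.\<close>

definition hanani_check :: "pt list list \<Rightarrow> nat list \<Rightarrow> pt \<Rightarrow> pt \<Rightarrow> bool" where
  "hanani_check Q cs p r \<longleftrightarrow> (let D = through p Q; s = [flip p, r, flip r] in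
     classes_check D cs [0, 1, 2, 3, 4, 5, 6, 7, 8, 9] \<and>
     list_all (\<lambda>z. list_all (\<lambda>x. x \<notin> set (fst z)) s \<or>
       (if list_all (\<lambda>x. x \<in> set (fst z)) s then snd z = 8 else snd z < 8)) (zip D cs))"

definition resolvable_check :: "pt list list \<Rightarrow> nat list \<Rightarrow> pt \<Rightarrow> bool" where
  "resolvable_check Q cs p \<longleftrightarrow>
     classes_check (filter (\<lambda>e. flip p \<notin> set e) (through p Q)) cs [0, 1, 2, 3, 4, 5, 6, 7]"


section \<open>Transport of the local colourings\<close>

lemma hanani_at_image:
  assumes "hanani_at S x s" "inj_on f X" "\<And>b. b \<in> S \<Longrightarrow> b \<subseteq> X" "x \<in> X" "s \<subseteq> X"
  shows "hanani_at ((`) f ` S) (f x) (f ` s)"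
proof -
  obtain c :: "_ \<Rightarrow> nat" where c: "proper_coloring c (derived_blocks S x)"
    "\<And>d. d \<in> derived_blocks S x \<Longrightarrow> c d < 10 \<and>
        (d \<inter> s \<noteq> {} \<longrightarrow> (if d = s then c d = 8 else c d < 8))"
    using assms(1) unfolding hanani_at_def by blast
  have sub: "d \<subseteq> X" if "d \<in> derived_blocks S x" for d
    using that assms(3) unfolding derived_blocks_def by blast
  obtain c' where c': "proper_coloring c' ((`) f ` derived_blocks S x)"
    "\<And>d. d \<in> derived_blocks S x \<Longrightarrow> c' (f ` d) = c d"
    using proper_coloring_image[OF c(1) sub assms(2)] by blast
  have key: "c' (f ` d) < 10 \<and> (f ` d \<inter> f ` s \<noteq> {} \<longrightarrow>
      (if f ` d = f ` s then c' (f ` d) = 8 else c' (f ` d) < 8))"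
    if d: "d \<in> derived_blocks S x" for d
    unfolding c'(2)[OF d] inj_on_image_eq_iff[OF assms(2) sub[OF d] assms(5)]
      inj_on_image_Int[OF assms(2) sub[OF d] assms(5), symmetric] image_is_empty
    using c(2)[OF d] .
  have eq: "derived_blocks ((`) f ` S) (f x) = (`) f ` derived_blocks S x"
    by (rule derived_blocks_image[where X = X]) (use assms in simp_all)
  show ?thesis
    unfolding hanani_at_def eq
  proof (intro exI[of _ c'] conjI[OF c'(1)] ballI)
    fix e assume "e \<in> (`) f ` derived_blocks S x"
    then obtain d where d: "d \<in> derived_blocks S x" "e = f ` d" by blast
    show "c' e < 10 \<and> (e \<inter> f ` s \<noteq> {} \<longrightarrow> (if e = f ` s then c' e = 8 else c' e < 8))"
      unfolding d(2) by (rule key[OF d(1)])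
  qed
qed

lemma resolvable_at_image:
  assumes "resolvable_at S x x'" "inj_on f X" "\<And>b. b \<in> S \<Longrightarrow> b \<subseteq> X" "x \<in> X" "x' \<in> X"
  shows "resolvable_at ((`) f ` S) (f x) (f x')"
proof -
  let ?D = "{d \<in> derived_blocks S x. x' \<notin> d}"
  obtain c :: "_ \<Rightarrow> nat" where c: "proper_coloring c ?D" "\<And>d. d \<in> ?D \<Longrightarrow> c d < 8"
    using assms(1) unfolding resolvable_at_def by blast
  have sub: "d \<subseteq> X" if "d \<in> derived_blocks S x" for d
    using that assms(3) unfolding derived_blocks_def by blast
  hence sub': "d \<subseteq> X" if "d \<in> ?D" for d
    using that by blast
  obtain c' where c': "proper_coloring c' ((`) f ` ?D)" "\<And>d. d \<in> ?D \<Longrightarrow> c' (f ` d) = c d"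
    using proper_coloring_image[OF c(1) sub' assms(2)] by blast
  have "f x' \<in> f ` d \<longleftrightarrow> x' \<in> d" if "d \<in> derived_blocks S x" for d
    using inj_on_image_mem_iff[OF assms(2,5) sub[OF that]] .
  hence D_eq: "{d \<in> (`) f ` derived_blocks S x. f x' \<notin> d} = (`) f ` ?D" by blast
  have lt: "c' d < 8" if "d \<in> (`) f ` ?D" for d
    using that c(2) c'(2) by auto
  have eq: "derived_blocks ((`) f ` S) (f x) = (`) f ` derived_blocks S x"
    by (rule derived_blocks_image[where X = X]) (use assms in simp_all)
  show ?thesis
    unfolding resolvable_at_def eq D_eq using c'(1) lt unfolding D_eq[symmetric] by blast
qed

section \<open>Soundness of the checks\<close>

lemma set_points: "x \<in> set points"
  by (cases x) (simp_all add: points_def)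

lemma UNIV_pt: "(UNIV :: pt set) = set points"
  using set_points by blast

lemma finite_pt: "finite (A :: pt set)"
  by (rule finite_subset[of _ "set points"]) (use set_points in auto)

lemma card_pt: "card (UNIV :: pt set) = 20"
  unfolding UNIV_pt by (subst distinct_card) (simp_all add: points_def)

lemma flip_flip [simp]: "flip (flip x) = x"
  by (cases x) simp_all

lemma flip_neq [simp]: "flip x \<noteq> x"
  by (cases x) simp_all

lemma neq_flip [simp]: "x \<noteq> flip x"
  using flip_neq[of x] by metis

lemma inj_flip: "inj flip"
  by (rule inj_on_inverseI[where g = flip]) simp

definition system :: "pt list list \<Rightarrow> pt set set" where
  "system Q = set ` set Q"

context
  fixes Q
  assumes check: "quads_check Q"
begin

lemma quads_block: "b \<in> set Q \<Longrightarrow> length b = 4 \<and> distinct b"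
  using check by (simp add: quads_check_def list_all_iff)

text \<open>The axiom of a quadruple system for the triples through \<open>p\<close>, together with
  the unions of fibres that \<open>local_pairs\<close> asks for.\<close>

definition covered :: "pt \<Rightarrow> bool" where
  "covered p \<longleftrightarrow> (\<forall>q r. q \<noteq> p \<longrightarrow> r \<noteq> p \<longrightarrow> q \<noteq> r \<longrightarrow> (\<exists>!b. b \<in> system Q \<and> {p, q, r} \<subseteq> b)) \<and>
     (\<forall>q. q \<noteq> p \<longrightarrow> q \<noteq> flip p \<longrightarrow> {p, flip p, q, flip q} \<in> system Q)"

lemma set_through: "d \<in> set (through p Q) \<Longrightarrow> length d = 3 \<and> distinct d \<and> p \<notin> set d"
  using quads_block by (auto simp: through_def length_remove1)

lemma derived_system: "derived_blocks (system Q) p = set ` set (through p Q)"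
proof -
  have "set (remove1 p b) = set b - {p}" if "b \<in> set Q" for b
    using quads_block[OF that] by simp
  thus ?thesis
    unfolding derived_blocks_def system_def through_def by (auto simp: image_iff) 
qed

lemma covered_check:
  assumes "point_check Q p"
  shows "covered p"
proof -
  define D where "D = through p Q"
  have ck: "length (concat (through q D)) = 18" "distinct (concat (through q D))"
    "q = flip p \<or> (\<exists>d\<in>set D. flip p \<in> set d \<and> q \<in> set d \<and> flip q \<in> set d)" if "q \<noteq> p" for q
    using assms that set_points[of q] unfolding point_check_def D_def[symmetric] Let_def
    by (auto simp: list_all_iff list_ex_iff)
  have D: "\<exists>b\<in>set Q. p \<in> set b \<and> d = remove1 p b" if "d \<in> set D" for d
    using that by (auto simp: D_def through_def)
  have block: "insert p (set d) \<in> system Q" if "d \<in> set D" for d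
  proof -
    obtain b where b: "b \<in> set Q" "p \<in> set b" "d = remove1 p b" using D \<open>d \<in> set D\<close> by blast
    hence "insert p (set d) = set b" using quads_block[OF b(1)] by auto
    thus ?thesis using b(1) by (simp add: system_def)
  qed
  show ?thesis
    unfolding covered_def
  proof (intro conjI allI impI)
    fix q r assume neq: "q \<noteq> p" "r \<noteq> p" "q \<noteq> r"
    define E where "E = through q D"
    have E: "p \<notin> set e" "q \<notin> set e" "insert q (set e) \<in> set ` set D" if "e \<in> set E" for e
    proof -
      obtain d where d: "d \<in> set D" "q \<in> set d" "e = remove1 q d"
        using \<open>e \<in> set E\<close> by (auto simp: E_def through_def)
      have "distinct d" "p \<notin> set d" using set_through d(1) by (auto simp: D_def)
      thus "p \<notin> set e" "q \<notin> set e" "insert q (set e) \<in> set ` set D"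
        using d by (auto simp: insert_absorb)
    qed
    \<comment> \<open>Exactly 18 points differ from \<open>p\<close> and \<open>q\<close>, so 18
      distinct entries exhaust them. This gives existence of the block; its uniqueness comes from
      distinctness of the concatenation.\<close>
    have "card (set (concat E)) = 18"
      using ck(1,2)[OF neq(1)] unfolding E_def by (simp only: distinct_card)
    moreover have sub: "set (concat E) \<subseteq> UNIV - {p, q}" using E(1,2) by auto
    moreover have "card (UNIV - {p, q}) = 18"
      using neq(1) card_pt finite_pt by (subst card_Diff_subset) auto
    ultimately have "set (concat E) = UNIV - {p, q}"
      using finite_pt by (intro card_subset_eq) auto
    hence "r \<in> set (concat E)" using neq by simp
    then obtain e where e: "e \<in> set E" "r \<in> set e" by auto
    then obtain d where d: "d \<in> set D" "set d = insert q (set e)" using E(3)[OF e(1)] by (metis imageE)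
    show "\<exists>!b. b \<in> system Q \<and> {p, q, r} \<subseteq> b"
    proof (rule ex1I[of _ "insert p (set d)"])
      show "insert p (set d) \<in> system Q \<and> {p, q, r} \<subseteq> insert p (set d)"
        using block[OF d(1)] d(2) e(2) by simp
    next
      fix b' assume b': "b' \<in> system Q \<and> {p, q, r} \<subseteq> b'"
      then obtain b where b: "b \<in> set Q" "b' = set b" by (auto simp: system_def)
      define e' where "e' = remove1 q (remove1 p b)"
      have "distinct b" using quads_block b(1) by blast
      have "remove1 p b \<in> set D" using b b' by (auto simp: D_def through_def)
      moreover have "q \<in> set (remove1 p b)" using b b' neq \<open>distinct b\<close> by simp
      ultimately have "e' \<in> set E" by (auto simp: E_def through_def e'_def)
      moreover have "r \<in> set e'" using b b' neq \<open>distinct b\<close> by (simp add: e'_def)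
      ultimately have "e' = e"
        using e ck(2)[OF neq(1)] unfolding E_def[symmetric] distinct_concat_iff by blast
      moreover have "set b = insert p (insert q (set e'))"
        using b b' \<open>distinct b\<close> by (auto simp: e'_def)
      ultimately show "b' = insert p (set d)" using b(2) d(2) by simp
    qed
  next
    fix q assume q: "q \<noteq> p" "q \<noteq> flip p"
    then obtain d where d: "d \<in> set D" "flip p \<in> set d" "q \<in> set d" "flip q \<in> set d"
      using ck(3) by blast
    have card_d: "card (set d) = 3" using set_through d(1) by (auto simp: D_def distinct_card)
    have "card {flip p, q, flip q} = 3"
      using q flip_neq[of q] by (auto simp: card_insert_if dest: injD[OF inj_flip])
    hence "{flip p, q, flip q} = set d"
      using d(2-4) card_d by (intro card_subset_eq) auto
    thus "{p, flip p, q, flip q} \<in> system Q" using block[OF d(1)] by simp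
  qed
qed

lemma classes_coloring:
  assumes "classes_check D cs ks"
  shows "\<exists>c. proper_coloring c (set ` set D) \<and>
    (\<forall>d\<in>set ` set D. (\<exists>e. set e = d \<and> (e, c d) \<in> set (zip D cs)) \<and> c d \<in> set ks)"
proof -
  \<comment> \<open>Colours belong to positions in \<open>D\<close> but are wanted for sets; any
    position holding the set supplies one.\<close>
  define c where "c d = (SOME k. \<exists>e. set e = d \<and> (e, k) \<in> set (zip D cs))" for d
  have len: "length cs = length D" and ks: "set cs \<subseteq> set ks"
    and dist: "\<And>k. k \<in> set ks \<Longrightarrow> distinct (concat (map fst (filter (\<lambda>z. snd z = k) (zip D cs))))"
    using assms by (auto simp: classes_check_def list_all_iff)
  have c: "\<exists>e. set e = d \<and> (e, c d) \<in> set (zip D cs)" if d: "d \<in> set ` set D" for d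
  proof -
    obtain e where e: "e \<in> set D" "d = set e" using d by blast
    then obtain i where "i < length D" "e = D ! i" by (metis in_set_conv_nth)
    hence "(e, cs ! i) \<in> set (zip D cs)" using len by (auto simp: set_zip)
    thus ?thesis unfolding c_def using e(2) by (intro someI_ex[of "\<lambda>k. \<exists>e. set e = d \<and> (e, k) \<in> set (zip D cs)"]) blast
  qed
  have ck: "c d \<in> set ks" if "d \<in> set ` set D" for d
    using c[OF that] ks set_zip_rightD by fastforce
  have "proper_coloring c (set ` set D)"
    unfolding proper_coloring_def
  proof (intro ballI impI)
    fix d1 d2 assume d: "d1 \<in> set ` set D" "d2 \<in> set ` set D" "c d1 = c d2" "d1 \<noteq> d2"
    obtain e1 where e1: "set e1 = d1" "(e1, c d1) \<in> set (zip D cs)" using c[OF d(1)] by blast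
    obtain e2 where e2: "set e2 = d2" "(e2, c d1) \<in> set (zip D cs)" using c[OF d(2)] d(3) by auto
    let ?L = "map fst (filter (\<lambda>z. snd z = c d1) (zip D cs))"
    have "e1 \<in> set ?L" "e2 \<in> set ?L" using e1 e2 by force+
    moreover have "e1 \<noteq> e2" using e1 e2 d(4) by blast
    moreover have "distinct (concat ?L)" using dist[OF ck[OF d(1)]] .
    ultimately show "d1 \<inter> d2 = {}"
      using e1(1) e2(1) unfolding distinct_concat_iff by blast
  qed
  thus ?thesis using c ck by (intro exI[of _ c]) simp
qed

lemma hanani_system:
  assumes "hanani_check Q cs p r" "r \<noteq> p" "r \<noteq> flip p"
  shows "hanani_at (system Q) p {flip p, r, flip r}"
proof -
  define D where "D = through p Q"
  have cc: "classes_check D cs [0, 1, 2, 3, 4, 5, 6, 7, 8, 9]"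
    and sp: "\<And>e k. (e, k) \<in> set (zip D cs) \<Longrightarrow>
      {flip p, r, flip r} \<inter> set e = {} \<or> (if {flip p, r, flip r} \<subseteq> set e then k = 8 else k < 8)"
    using assms(1) unfolding hanani_check_def D_def[symmetric] Let_def
    by (auto simp: list_all_iff split: if_splits)
  from classes_coloring[OF cc] obtain c where c0: "proper_coloring c (set ` set D) \<and>
    (\<forall>d\<in>set ` set D. (\<exists>e. set e = d \<and> (e, c d) \<in> set (zip D cs)) \<and>
      c d \<in> set [0, 1, 2, 3, 4, 5, 6, 7, 8, 9 :: nat])" ..
  have c: "proper_coloring c (set ` set D)"
    "\<And>d. d \<in> set ` set D \<Longrightarrow> \<exists>e. set e = d \<and> (e, c d) \<in> set (zip D cs)"
    "\<And>d. d \<in> set ` set D \<Longrightarrow> c d \<in> set [0, 1, 2, 3, 4, 5, 6, 7, 8, 9 :: nat]"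
    using c0 by blast+
  have card_s: "card {flip p, r, flip r} = 3"
    using assms(2,3) flip_neq[of r] by (auto simp: card_insert_if dest: injD[OF inj_flip])
  have eq: "derived_blocks (system Q) p = set ` set D"
    using derived_system by (simp add: D_def)
  show ?thesis
    unfolding hanani_at_def eq
  proof (intro exI[of _ c] conjI[OF c(1)] ballI)
    fix d assume d: "d \<in> set ` set D"
    then obtain e where e: "set e = d" "(e, c d) \<in> set (zip D cs)" using c(2) by blast
    have card_d: "card d = 3" using d set_through by (auto simp: D_def distinct_card)
    have "{flip p, r, flip r} \<subseteq> d \<longleftrightarrow> d = {flip p, r, flip r}"
      using card_subset_eq[of d "{flip p, r, flip r}"] card_d card_s finite_pt by auto
    moreover have "c d < 10" using c(3)[OF d] by auto
    ultimately show "c d < 10 \<and> (d \<inter> {flip p, r, flip r} \<noteq> {} \<longrightarrow>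
        (if d = {flip p, r, flip r} then c d = 8 else c d < 8))"
      using sp[OF e(2)] unfolding e(1) by (auto simp: Int_commute split: if_splits)
  qed
qed

lemma resolvable_system:
  assumes "resolvable_check Q cs p"
  shows "resolvable_at (system Q) p (flip p)"
proof -
  define D where "D = filter (\<lambda>e. flip p \<notin> set e) (through p Q)"
  have cc: "classes_check D cs [0, 1, 2, 3, 4, 5, 6, 7]"
    using assms unfolding resolvable_check_def D_def .
  from classes_coloring[OF cc] obtain c where c0: "proper_coloring c (set ` set D) \<and>
    (\<forall>d\<in>set ` set D. (\<exists>e. set e = d \<and> (e, c d) \<in> set (zip D cs)) \<and>
      c d \<in> set [0, 1, 2, 3, 4, 5, 6, 7 :: nat])" ..
  have c: "proper_coloring c (set ` set D)"
    "\<And>d. d \<in> set ` set D \<Longrightarrow> c d \<in> set [0, 1, 2, 3, 4, 5, 6, 7 :: nat]"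
    using c0 by blast+
  have eq: "{d \<in> derived_blocks (system Q) p. flip p \<notin> d} = set ` set D"
    using derived_system by (auto simp: D_def)
  have "c d < 8" if "d \<in> derived_blocks (system Q) p" "flip p \<notin> d" for d
  proof -
    have "d \<in> set ` set D" using that eq by blast
    thus ?thesis using c(2) by fastforce
  qed
  thus ?thesis unfolding resolvable_at_def eq using c(1) by blast
qed

lemma SQS_system:
  assumes "\<And>p. covered p"
  shows "SQS 20 UNIV (system Q)"
proof (rule SQSI)
  show "b \<subseteq> UNIV \<and> card b = 4" if "b \<in> system Q" for b
    using that quads_block by (auto simp: system_def distinct_card)
  fix t :: "pt set" assume "card t = 3"
  then obtain p q r where t: "t = {p, q, r}" "p \<noteq> q" "p \<noteq> r" "q \<noteq> r"
    by (auto simp: card_3_iff)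
  have "\<forall>q r. q \<noteq> p \<longrightarrow> r \<noteq> p \<longrightarrow> q \<noteq> r \<longrightarrow> (\<exists>!b. b \<in> system Q \<and> {p, q, r} \<subseteq> b)"
    using assms[of p] unfolding covered_def by (rule conjunct1)
  thus "\<exists>!b. b \<in> system Q \<and> t \<subseteq> b" using t(2-4) unfolding t(1) by metis
qed (use finite_pt card_pt in auto)

end

text \<open>Row \<open>p\<close> of each colour table, in the order of \<open>points\<close>, colours the blocks through \<open>p\<close> in their order in
  the list; for \<open>resolvable_check\<close>, only those missing \<open>flip p\<close>.\<close>

definition pair_quads :: "pt list list" where
  "pair_quads =
  [[A0, A1, B0, B1], [A0, A2, B0, B2], [A0, A3, B0, B3], [A0, A4, B0, B4], [A0, A5, B0, B5],
  [A0, A6, B0, B6], [A0, A7, B0, B7], [A0, A8, B0, B8], [A0, A9, B0, B9], [A1, A2, B1, B2],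
  [A1, A3, B1, B3], [A1, A4, B1, B4], [A1, A5, B1, B5], [A1, A6, B1, B6], [A1, A7, B1, B7],
  [A1, A8, B1, B8], [A1, A9, B1, B9], [A2, A3, B2, B3], [A2, A4, B2, B4], [A2, A5, B2, B5],
  [A2, A6, B2, B6], [A2, A7, B2, B7], [A2, A8, B2, B8], [A2, A9, B2, B9], [A3, A4, B3, B4],
  [A3, A5, B3, B5], [A3, A6, B3, B6], [A3, A7, B3, B7], [A3, A8, B3, B8], [A3, A9, B3, B9],
  [A4, A5, B4, B5], [A4, A6, B4, B6], [A4, A7, B4, B7], [A4, A8, B4, B8], [A4, A9, B4, B9],
  [A5, A6, B5, B6], [A5, A7, B5, B7], [A5, A8, B5, B8], [A5, A9, B5, B9], [A6, A7, B6, B7],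
  [A6, A8, B6, B8], [A6, A9, B6, B9], [A7, A8, B7, B8], [A7, A9, B7, B9], [A8, A9, B8, B9]]"

text \<open>The system for circles that miss infinity. Of its 285 blocks, 45 are the unions of two
  fibres in \<open>pair_quads\<close>; the other 240 meet four fibres each.\<close>

definition quads1 :: "pt list list" where
  "quads1 = pair_quads @
  [[A0, A1, A2, A9], [A0, A1, A3, B4], [A0, A1, A4, B3], [A0, A1, A5, A8], [A0, A1, A6, B7],
  [A0, A1, A7, B6], [A0, A1, B2, B9], [A0, A1, B5, B8], [A0, A2, A3, B5], [A0, A2, A4, A7],
  [A0, A2, A5, B3], [A0, A2, A6, B8], [A0, A2, A8, B6], [A0, A2, B1, B9], [A0, A2, B4, B7],
  [A0, A3, A4, B1], [A0, A3, A5, B2], [A0, A3, A6, A9], [A0, A3, A7, A8], [A0, A3, B6, B9],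
  [A0, A3, B7, B8], [A0, A4, A5, A6], [A0, A4, A8, B9], [A0, A4, A9, B8], [A0, A4, B2, B7],
  [A0, A4, B5, B6], [A0, A5, A7, B9], [A0, A5, A9, B7], [A0, A5, B1, B8], [A0, A5, B4, B6],
  [A0, A6, A7, B1], [A0, A6, A8, B2], [A0, A6, B3, B9], [A0, A6, B4, B5], [A0, A7, A9, B5],
  [A0, A7, B2, B4], [A0, A7, B3, B8], [A0, A8, A9, B4], [A0, A8, B1, B5], [A0, A8, B3, B7],
  [A0, A9, B1, B2], [A0, A9, B3, B6], [A0, B1, B3, B4], [A0, B1, B6, B7], [A0, B2, B3, B5],
  [A0, B2, B6, B8], [A0, B4, B8, B9], [A0, B5, B7, B9], [A1, A2, A3, A6], [A1, A2, A4, B5],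
  [A1, A2, A5, B4], [A1, A2, A7, B8], [A1, A2, A8, B7], [A1, A2, B0, B9], [A1, A2, B3, B6],
  [A1, A3, A4, B0], [A1, A3, A5, A7], [A1, A3, A8, B9], [A1, A3, A9, B8], [A1, A3, B2, B6],
  [A1, A3, B5, B7], [A1, A4, A5, B2], [A1, A4, A6, A8], [A1, A4, A7, A9], [A1, A4, B6, B8],
  [A1, A4, B7, B9], [A1, A5, A6, B9], [A1, A5, A9, B6], [A1, A5, B0, B8], [A1, A5, B3, B7],
  [A1, A6, A7, B0], [A1, A6, A9, B5], [A1, A6, B2, B3], [A1, A6, B4, B8], [A1, A7, A8, B2],
  [A1, A7, B3, B5], [A1, A7, B4, B9], [A1, A8, A9, B3], [A1, A8, B0, B5], [A1, A8, B4, B6],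
  [A1, A9, B0, B2], [A1, A9, B4, B7], [A1, B0, B3, B4], [A1, B0, B6, B7], [A1, B2, B4, B5],
  [A1, B2, B7, B8], [A1, B3, B8, B9], [A1, B5, B6, B9], [A2, A3, A4, A8], [A2, A3, A5, B0],
  [A2, A3, A7, B9], [A2, A3, A9, B7], [A2, A3, B1, B6], [A2, A3, B4, B8], [A2, A4, A5, B1],
  [A2, A4, A6, B9], [A2, A4, A9, B6], [A2, A4, B0, B7], [A2, A4, B3, B8], [A2, A5, A6, A7],
  [A2, A5, A8, A9], [A2, A5, B6, B7], [A2, A5, B8, B9], [A2, A6, A8, B0], [A2, A6, A9, B4],
  [A2, A6, B1, B3], [A2, A6, B5, B7], [A2, A7, A8, B1], [A2, A7, A9, B3], [A2, A7, B0, B4],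
  [A2, A7, B5, B6], [A2, A8, B3, B4], [A2, A8, B5, B9], [A2, A9, B0, B1], [A2, A9, B5, B8],
  [A2, B0, B3, B5], [A2, B0, B6, B8], [A2, B1, B4, B5], [A2, B1, B7, B8], [A2, B3, B7, B9],
  [A2, B4, B6, B9], [A3, A4, A5, A9], [A3, A4, A6, B7], [A3, A4, A7, B6], [A3, A4, B2, B8],
  [A3, A4, B5, B9], [A3, A5, A6, B8], [A3, A5, A8, B6], [A3, A5, B1, B7], [A3, A5, B4, B9],
  [A3, A6, A7, B4], [A3, A6, A8, B5], [A3, A6, B0, B9], [A3, A6, B1, B2], [A3, A7, A9, B2],
  [A3, A7, B0, B8], [A3, A7, B1, B5], [A3, A8, A9, B1], [A3, A8, B0, B7], [A3, A8, B2, B4],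
  [A3, A9, B0, B6], [A3, A9, B4, B5], [A3, B0, B1, B4], [A3, B0, B2, B5], [A3, B1, B8, B9],
  [A3, B2, B7, B9], [A3, B4, B6, B7], [A3, B5, B6, B8], [A4, A5, A7, B8], [A4, A5, A8, B7],
  [A4, A5, B0, B6], [A4, A5, B3, B9], [A4, A6, A7, B3], [A4, A6, A9, B2], [A4, A6, B0, B5],
  [A4, A6, B1, B8], [A4, A7, A8, B5], [A4, A7, B0, B2], [A4, A7, B1, B9], [A4, A8, A9, B0],
  [A4, A8, B1, B6], [A4, A8, B2, B3], [A4, A9, B1, B7], [A4, A9, B3, B5], [A4, B0, B1, B3],
  [A4, B0, B8, B9], [A4, B1, B2, B5], [A4, B2, B6, B9], [A4, B3, B6, B7], [A4, B5, B7, B8],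
  [A5, A6, A8, B3], [A5, A6, A9, B1], [A5, A6, B0, B4], [A5, A6, B2, B7], [A5, A7, A8, B4],
  [A5, A7, A9, B0], [A5, A7, B1, B3], [A5, A7, B2, B6], [A5, A8, B0, B1], [A5, A8, B2, B9],
  [A5, A9, B2, B8], [A5, A9, B3, B4], [A5, B0, B2, B3], [A5, B0, B7, B9], [A5, B1, B2, B4],
  [A5, B1, B6, B9], [A5, B3, B6, B8], [A5, B4, B7, B8], [A6, A7, A8, A9], [A6, A7, B2, B5],
  [A6, A7, B8, B9], [A6, A8, B1, B4], [A6, A8, B7, B9], [A6, A9, B0, B3], [A6, A9, B7, B8],
  [A6, B0, B1, B7], [A6, B0, B2, B8], [A6, B1, B5, B9], [A6, B2, B4, B9], [A6, B3, B4, B7],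
  [A6, B3, B5, B8], [A7, A8, B0, B3], [A7, A8, B6, B9], [A7, A9, B1, B4], [A7, A9, B6, B8],
  [A7, B0, B1, B6], [A7, B0, B5, B9], [A7, B1, B2, B8], [A7, B2, B3, B9], [A7, B3, B4, B6],
  [A7, B4, B5, B8], [A8, A9, B2, B5], [A8, A9, B6, B7], [A8, B0, B2, B6], [A8, B0, B4, B9],
  [A8, B1, B2, B7], [A8, B1, B3, B9], [A8, B3, B5, B6], [A8, B4, B5, B7], [A9, B0, B4, B8],
  [A9, B0, B5, B7], [A9, B1, B3, B8], [A9, B1, B5, B6], [A9, B2, B3, B7], [A9, B2, B4, B6],
  [B0, B1, B2, B9], [B0, B1, B5, B8], [B0, B2, B4, B7], [B0, B3, B6, B9], [B0, B3, B7, B8],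
  [B0, B4, B5, B6], [B1, B2, B3, B6], [B1, B3, B5, B7], [B1, B4, B6, B8], [B1, B4, B7, B9],
  [B2, B3, B4, B8], [B2, B5, B6, B7], [B2, B5, B8, B9], [B3, B4, B5, B9], [B6, B7, B8, B9]]"

definition colours1 :: "nat list list" where
  "colours1 =
  [[4, 1, 5, 0, 6, 2, 3, 7, 2, 7, 3, 0, 1, 6, 5, 0, 4, 5, 6, 7, 3, 2, 4, 6, 1, 3, 5, 7, 1, 6,
  3, 7, 1, 4, 1, 0, 4, 3, 5, 2, 2, 0, 7, 4, 6, 5, 2, 0], [2, 6, 3, 1, 7, 0, 5, 4, 1, 0, 4, 3,
  5, 6, 7, 5, 2, 0, 7, 4, 3, 7, 2, 1, 6, 4, 3, 5, 0, 6, 4, 6, 0, 5, 6, 5, 7, 4, 7, 3, 3, 0,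
  1, 2, 2, 1, 2, 1], [3, 0, 5, 2, 6, 7, 1, 4, 4, 7, 5, 1, 0, 2, 6, 1, 3, 6, 7, 5, 2, 4, 3, 2,
  6, 0, 0, 6, 1, 7, 5, 1, 7, 2, 2, 4, 7, 3, 3, 4, 0, 5, 1, 4, 6, 3, 5, 0], [5, 2, 0, 4, 3, 1,
  6, 7, 4, 3, 6, 7, 2, 1, 0, 5, 1, 0, 6, 7, 3, 7, 1, 2, 6, 4, 0, 3, 5, 2, 7, 6, 5, 2, 5, 4,
  3, 4, 2, 0, 0, 1, 6, 7, 1, 3, 4, 5], [7, 2, 1, 4, 6, 5, 3, 0, 5, 3, 0, 2, 6, 1, 4, 0, 6, 1,
  3, 7, 4, 2, 5, 4, 6, 7, 7, 1, 5, 3, 0, 7, 6, 3, 3, 1, 5, 4, 7, 5, 0, 1, 2, 0, 4, 2, 6, 2],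
  [6, 5, 0, 2, 4, 3, 7, 1, 4, 3, 1, 5, 7, 0, 2, 6, 3, 7, 1, 0, 2, 5, 1, 2, 4, 7, 6, 7, 4, 0,
  4, 0, 3, 6, 0, 2, 1, 5, 5, 3, 4, 6, 7, 1, 2, 6, 3, 5], [6, 2, 7, 1, 5, 3, 0, 4, 1, 7, 3, 0,
  2, 4, 5, 5, 7, 4, 6, 3, 0, 4, 0, 3, 5, 6, 2, 2, 0, 3, 6, 6, 4, 2, 5, 1, 6, 4, 0, 2, 5, 3,
  7, 1, 1, 7, 1, 7], [0, 5, 6, 7, 3, 1, 4, 2, 7, 4, 6, 5, 2, 3, 1, 3, 6, 1, 4, 0, 2, 7, 2, 5,
  1, 0, 0, 1, 4, 3, 2, 3, 2, 5, 1, 0, 7, 4, 7, 5, 7, 3, 4, 6, 6, 0, 6, 5], [5, 0, 4, 7, 1, 2,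
  6, 3, 7, 6, 2, 3, 0, 1, 4, 1, 3, 5, 2, 6, 4, 7, 3, 5, 2, 0, 6, 0, 4, 3, 5, 4, 1, 0, 2, 6,
  7, 0, 7, 5, 7, 1, 6, 3, 4, 1, 2, 5], [5, 6, 4, 0, 3, 2, 7, 1, 1, 6, 7, 4, 0, 2, 3, 2, 3, 6,
  1, 7, 4, 0, 5, 4, 3, 0, 7, 0, 7, 1, 2, 2, 1, 3, 4, 5, 3, 7, 0, 2, 1, 4, 6, 5, 5, 6, 6, 5],
  [4, 1, 7, 0, 3, 6, 2, 5, 6, 2, 7, 1, 5, 0, 3, 3, 5, 0, 2, 7, 4, 0, 5, 7, 4, 3, 6, 4, 3, 2,
  5, 1, 1, 6, 2, 6, 4, 2, 1, 5, 0, 7, 0, 1, 3, 7, 4, 6], [7, 2, 4, 5, 3, 0, 1, 6, 3, 5, 6, 1,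
  2, 4, 0, 1, 4, 0, 5, 7, 6, 1, 3, 7, 4, 0, 6, 7, 2, 6, 3, 0, 0, 3, 2, 6, 4, 7, 2, 4, 3, 1,
  1, 5, 5, 7, 2, 5], [0, 2, 5, 1, 4, 7, 3, 6, 4, 6, 2, 5, 1, 7, 3, 7, 3, 0, 6, 5, 1, 4, 3, 0,
  1, 2, 7, 1, 3, 5, 4, 0, 6, 0, 5, 2, 7, 2, 7, 4, 6, 3, 6, 2, 5, 1, 0, 4], [5, 7, 6, 3, 0, 2,
  1, 4, 1, 4, 3, 6, 7, 0, 2, 4, 5, 0, 6, 2, 3, 0, 7, 2, 1, 3, 6, 1, 2, 3, 6, 5, 4, 2, 0, 5,
  1, 4, 4, 3, 6, 5, 7, 1, 0, 7, 7, 5], [7, 0, 6, 4, 2, 3, 5, 1, 1, 3, 4, 2, 5, 6, 0, 5, 6, 3,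
  4, 2, 7, 2, 0, 6, 1, 4, 3, 7, 5, 0, 3, 4, 1, 5, 2, 7, 1, 6, 0, 7, 2, 4, 1, 5, 0, 6, 7, 3],
  [6, 0, 1, 5, 2, 3, 4, 7, 2, 1, 3, 5, 4, 7, 0, 4, 3, 5, 7, 6, 1, 4, 2, 7, 6, 3, 5, 7, 6, 0,
  5, 3, 0, 6, 1, 1, 4, 1, 7, 0, 5, 4, 0, 2, 2, 6, 2, 3], [0, 3, 5, 7, 4, 1, 2, 6, 7, 4, 2, 3,
  5, 1, 6, 6, 5, 0, 1, 4, 2, 3, 1, 2, 7, 0, 6, 0, 1, 4, 2, 7, 5, 4, 7, 5, 6, 6, 7, 2, 4, 0,
  0, 3, 3, 1, 5, 3], [5, 3, 2, 7, 4, 6, 0, 1, 7, 4, 0, 1, 6, 2, 3, 5, 4, 6, 0, 1, 2, 1, 3, 0,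
  6, 7, 5, 2, 3, 6, 2, 7, 0, 3, 7, 6, 4, 1, 4, 2, 3, 0, 1, 5, 7, 5, 5, 4], [3, 7, 6, 2, 0, 1,
  4, 5, 6, 7, 5, 4, 2, 1, 0, 0, 4, 2, 1, 3, 5, 3, 1, 5, 4, 2, 7, 6, 1, 0, 5, 6, 3, 3, 4, 0,
  5, 0, 2, 4, 6, 3, 7, 2, 1, 7, 6, 7], [3, 4, 2, 1, 6, 5, 0, 7, 7, 6, 2, 1, 5, 4, 0, 1, 6, 2,
  5, 0, 3, 4, 7, 0, 3, 5, 3, 0, 5, 7, 0, 4, 5, 7, 3, 2, 4, 4, 3, 2, 2, 7, 1, 6, 6, 6, 1, 1]]"

text \<open>The system for circles through infinity but not through zero.\<close>

definition quads2 :: "pt list list" where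
  "quads2 = pair_quads @
  [[A0, A1, A2, B9], [A0, A1, A3, B4], [A0, A1, A4, B5], [A0, A1, A5, B3], [A0, A1, A6, B7],
  [A0, A1, A7, A9], [A0, A1, A8, B6], [A0, A1, B2, B8], [A0, A2, A3, B5], [A0, A2, A4, B3],
  [A0, A2, A5, A9], [A0, A2, A6, B8], [A0, A2, A7, B6], [A0, A2, A8, B7], [A0, A2, B1, B4],
  [A0, A3, A4, B9], [A0, A3, A5, B8], [A0, A3, A6, A9], [A0, A3, A7, B1], [A0, A3, A8, B2],
  [A0, A3, B6, B7], [A0, A4, A5, B6], [A0, A4, A6, B1], [A0, A4, A7, B2], [A0, A4, A8, A9],
  [A0, A4, B7, B8], [A0, A5, A6, B2], [A0, A5, A7, B9], [A0, A5, A8, B1], [A0, A5, B4, B7],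
  [A0, A6, A7, B4], [A0, A6, A8, B9], [A0, A6, B3, B5], [A0, A7, A8, B3], [A0, A7, B5, B8],
  [A0, A8, B4, B5], [A0, A9, B1, B7], [A0, A9, B2, B5], [A0, A9, B3, B6], [A0, A9, B4, B8],
  [A0, B1, B2, B9], [A0, B1, B3, B8], [A0, B1, B5, B6], [A0, B2, B3, B7], [A0, B2, B4, B6],
  [A0, B3, B4, B9], [A0, B5, B7, B9], [A0, B6, B8, B9], [A1, A2, A3, A6], [A1, A2, A4, B6],
  [A1, A2, A5, A7], [A1, A2, A8, B3], [A1, A2, A9, B0], [A1, A2, B4, B8], [A1, A2, B5, B7],
  [A1, A3, A4, A7], [A1, A3, A5, B7], [A1, A3, A8, B0], [A1, A3, A9, B8], [A1, A3, B2, B5],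
  [A1, A3, B6, B9], [A1, A4, A5, B9], [A1, A4, A6, B8], [A1, A4, A8, B7], [A1, A4, A9, B3],
  [A1, A4, B0, B2], [A1, A5, A6, B0], [A1, A5, A8, B2], [A1, A5, A9, B4], [A1, A5, B6, B8],
  [A1, A6, A7, A8], [A1, A6, A9, B2], [A1, A6, B3, B4], [A1, A6, B5, B9], [A1, A7, B0, B9],
  [A1, A7, B2, B6], [A1, A7, B3, B8], [A1, A7, B4, B5], [A1, A8, A9, B5], [A1, A8, B4, B9],
  [A1, A9, B6, B7], [A1, B0, B3, B7], [A1, B0, B4, B6], [A1, B0, B5, B8], [A1, B2, B3, B9],
  [A1, B2, B4, B7], [A1, B3, B5, B6], [A1, B7, B8, B9], [A2, A3, A4, A5], [A2, A3, A7, B0],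
  [A2, A3, A8, B4], [A2, A3, A9, B1], [A2, A3, B6, B8], [A2, A3, B7, B9], [A2, A4, A6, B0],
  [A2, A4, A7, B1], [A2, A4, A8, B5], [A2, A4, A9, B7], [A2, A4, B8, B9], [A2, A5, A6, A8],
  [A2, A5, B0, B9], [A2, A5, B1, B3], [A2, A5, B4, B6], [A2, A5, B7, B8], [A2, A6, A7, B5],
  [A2, A6, A9, B4], [A2, A6, B1, B7], [A2, A6, B3, B9], [A2, A7, A8, B9], [A2, A7, A9, B8],
  [A2, A7, B3, B4], [A2, A8, A9, B6], [A2, A8, B0, B1], [A2, A9, B3, B5], [A2, B0, B3, B8],
  [A2, B0, B4, B7], [A2, B0, B5, B6], [A2, B1, B5, B8], [A2, B1, B6, B9], [A2, B3, B6, B7],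
  [A2, B4, B5, B9], [A3, A4, A6, A8], [A3, A4, A9, B0], [A3, A4, B1, B6], [A3, A4, B2, B7],
  [A3, A4, B5, B8], [A3, A5, A6, B1], [A3, A5, A7, B4], [A3, A5, A8, A9], [A3, A5, B0, B6],
  [A3, A5, B2, B9], [A3, A6, A7, B2], [A3, A6, B0, B9], [A3, A6, B4, B8], [A3, A6, B5, B7],
  [A3, A7, A8, B6], [A3, A7, A9, B5], [A3, A7, B8, B9], [A3, A8, B1, B7], [A3, A8, B5, B9],
  [A3, A9, B2, B6], [A3, A9, B4, B7], [A3, B0, B1, B5], [A3, B0, B2, B4], [A3, B0, B7, B8],
  [A3, B1, B2, B8], [A3, B1, B4, B9], [A3, B4, B5, B6], [A4, A5, A6, B3], [A4, A5, A7, A8],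
  [A4, A5, A9, B2], [A4, A5, B0, B8], [A4, A5, B1, B7], [A4, A6, A7, A9], [A4, A6, B2, B5],
  [A4, A6, B7, B9], [A4, A7, B0, B5], [A4, A7, B3, B9], [A4, A7, B6, B8], [A4, A8, B0, B9],
  [A4, A8, B1, B2], [A4, A8, B3, B6], [A4, A9, B1, B8], [A4, A9, B5, B6], [A4, B0, B1, B3],
  [A4, B0, B6, B7], [A4, B1, B5, B9], [A4, B2, B3, B8], [A4, B2, B6, B9], [A4, B3, B5, B7],
  [A5, A6, A7, B8], [A5, A6, A9, B7], [A5, A6, B4, B9], [A5, A7, A9, B0], [A5, A7, B1, B2],
  [A5, A7, B3, B6], [A5, A8, B0, B7], [A5, A8, B3, B4], [A5, A8, B6, B9], [A5, A9, B1, B6],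
  [A5, A9, B3, B8], [A5, B0, B1, B4], [A5, B0, B2, B3], [A5, B1, B8, B9], [A5, B2, B4, B8],
  [A5, B2, B6, B7], [A5, B3, B7, B9], [A6, A7, B0, B3], [A6, A7, B1, B9], [A6, A8, A9, B0],
  [A6, A8, B1, B5], [A6, A8, B2, B3], [A6, A8, B4, B7], [A6, A9, B1, B3], [A6, A9, B5, B8],
  [A6, B0, B1, B8], [A6, B0, B2, B7], [A6, B0, B4, B5], [A6, B1, B2, B4], [A6, B2, B8, B9],
  [A6, B3, B7, B8], [A7, A8, A9, B1], [A7, A8, B0, B4], [A7, A8, B2, B5], [A7, A9, B2, B3],
  [A7, A9, B4, B6], [A7, B0, B1, B6], [A7, B0, B2, B8], [A7, B1, B3, B5], [A7, B1, B4, B8],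
  [A7, B2, B4, B9], [A7, B5, B6, B9], [A8, A9, B2, B4], [A8, A9, B3, B7], [A8, B0, B2, B6],
  [A8, B0, B3, B5], [A8, B1, B3, B9], [A8, B1, B4, B6], [A8, B2, B7, B9], [A8, B5, B6, B7],
  [A9, B0, B1, B2], [A9, B0, B3, B4], [A9, B0, B5, B7], [A9, B0, B6, B8], [A9, B1, B4, B5],
  [A9, B2, B7, B8], [B0, B1, B7, B9], [B0, B2, B5, B9], [B0, B3, B6, B9], [B0, B4, B8, B9],
  [B1, B2, B3, B6], [B1, B2, B5, B7], [B1, B3, B4, B7], [B1, B6, B7, B8], [B2, B3, B4, B5],
  [B2, B5, B6, B8], [B3, B4, B6, B8], [B3, B5, B8, B9], [B4, B5, B7, B8], [B4, B6, B7, B9]]"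

definition colours2 :: "nat list list" where
  "colours2 =
  [[0, 6, 2, 7, 3, 4, 1, 5, 8, 3, 1, 2, 9, 5, 4, 8, 7, 8, 4, 5, 2, 7, 0, 9, 0, 4, 7, 6, 9, 3,
  1, 3, 5, 6, 9, 0, 2, 7, 6, 8, 1, 6, 3, 0, 4, 2, 1, 0, 3, 4, 1, 5, 8, 2, 5, 7, 6], [6, 2, 7,
  4, 5, 0, 1, 3, 8, 4, 9, 0, 1, 7, 3, 2, 5, 6, 1, 8, 0, 5, 7, 9, 2, 3, 8, 0, 4, 5, 7, 8, 5,
  6, 9, 4, 6, 2, 9, 9, 1, 5, 2, 0, 7, 4, 6, 7, 1, 4, 2, 3, 1, 3, 8, 8, 6], [5, 7, 0, 2, 6, 1,
  3, 4, 8, 3, 8, 1, 7, 6, 2, 9, 0, 9, 8, 4, 6, 2, 5, 1, 5, 6, 1, 4, 7, 2, 4, 9, 7, 6, 0, 2,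
  1, 3, 9, 8, 0, 3, 5, 7, 5, 1, 8, 0, 8, 5, 9, 7, 3, 2, 6, 4, 4], [1, 4, 2, 3, 7, 0, 5, 6, 8,
  8, 3, 0, 9, 6, 2, 5, 4, 9, 1, 2, 3, 5, 0, 7, 5, 7, 4, 0, 1, 6, 7, 2, 6, 9, 8, 3, 0, 1, 8,
  4, 8, 5, 2, 1, 9, 4, 3, 8, 2, 3, 7, 9, 6, 0, 7, 1, 5], [2, 4, 5, 1, 0, 7, 6, 3, 8, 6, 9, 4,
  5, 8, 3, 7, 0, 8, 5, 2, 9, 1, 0, 7, 3, 1, 0, 2, 4, 6, 0, 6, 2, 8, 7, 6, 9, 1, 4, 7, 2, 4,
  3, 8, 7, 1, 5, 6, 4, 5, 3, 3, 9, 1, 2, 0, 5], [5, 2, 0, 4, 1, 7, 3, 6, 8, 0, 7, 9, 6, 3, 2,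
  8, 4, 6, 7, 5, 8, 4, 3, 1, 8, 5, 4, 3, 9, 2, 1, 5, 0, 2, 6, 9, 7, 2, 3, 0, 4, 6, 0, 1, 9,
  8, 9, 2, 3, 4, 5, 6, 7, 7, 8, 5, 1], [7, 3, 0, 5, 4, 1, 2, 6, 8, 8, 3, 2, 6, 5, 0, 1, 4, 7,
  1, 9, 5, 4, 2, 0, 2, 8, 9, 5, 4, 6, 9, 0, 6, 4, 8, 3, 7, 3, 8, 5, 4, 6, 3, 8, 7, 0, 2, 3,
  7, 1, 7, 5, 1, 6, 9, 2, 0], [7, 3, 1, 2, 5, 4, 6, 0, 8, 2, 3, 4, 9, 1, 8, 5, 6, 5, 7, 9, 6,
  4, 8, 1, 9, 6, 2, 7, 4, 0, 6, 0, 8, 5, 3, 2, 3, 8, 4, 1, 7, 0, 8, 9, 1, 5, 1, 4, 3, 6, 7,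
  2, 5, 7, 9, 2, 0], [5, 7, 6, 4, 2, 1, 0, 3, 8, 2, 8, 0, 4, 3, 7, 9, 6, 1, 9, 6, 8, 5, 0, 3,
  7, 5, 9, 0, 3, 4, 3, 5, 6, 1, 2, 7, 1, 9, 8, 2, 0, 4, 6, 8, 2, 4, 2, 8, 4, 1, 7, 7, 3, 6,
  5, 5, 9], [5, 2, 1, 4, 3, 0, 6, 7, 6, 4, 7, 0, 3, 2, 1, 0, 5, 4, 3, 7, 1, 2, 3, 7, 5, 6, 6,
  0, 1, 3, 7, 1, 4, 5, 5, 2, 6, 6, 4, 2, 1, 0, 7, 3, 4, 0, 5, 2], [4, 7, 3, 0, 6, 2, 5, 1, 8,
  0, 2, 3, 7, 1, 9, 6, 8, 9, 5, 3, 8, 6, 4, 1, 1, 5, 4, 0, 8, 7, 9, 4, 7, 2, 8, 2, 0, 1, 4,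
  8, 6, 3, 1, 9, 3, 7, 0, 9, 5, 5, 7, 3, 4, 6, 2, 0, 5], [3, 7, 5, 0, 1, 4, 6, 2, 8, 8, 7, 2,
  6, 4, 1, 9, 0, 2, 9, 0, 5, 1, 3, 6, 1, 9, 0, 6, 4, 3, 3, 5, 6, 8, 7, 8, 7, 4, 5, 0, 8, 1,
  7, 6, 3, 5, 2, 1, 4, 9, 0, 5, 2, 3, 9, 7, 8], [4, 2, 5, 1, 6, 7, 3, 0, 8, 8, 9, 2, 3, 7, 1,
  6, 0, 3, 5, 1, 6, 4, 0, 9, 8, 4, 0, 2, 7, 6, 0, 9, 4, 7, 3, 7, 8, 2, 5, 2, 1, 8, 5, 8, 1,
  9, 6, 5, 6, 7, 3, 4, 2, 9, 0, 4, 1], [6, 1, 2, 3, 5, 0, 7, 4, 8, 8, 4, 9, 0, 7, 3, 5, 2, 5,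
  6, 4, 9, 2, 0, 3, 0, 3, 8, 1, 7, 9, 7, 5, 2, 9, 1, 0, 6, 9, 2, 3, 1, 1, 6, 5, 8, 4, 2, 3,
  8, 7, 0, 4, 8, 6, 7, 5, 6], [1, 0, 5, 4, 7, 2, 6, 3, 8, 5, 2, 3, 7, 9, 6, 8, 0, 8, 1, 3, 2,
  6, 4, 9, 1, 6, 0, 9, 7, 3, 8, 9, 2, 3, 7, 0, 5, 2, 9, 0, 4, 8, 6, 0, 3, 1, 4, 7, 5, 5, 4,
  2, 8, 1, 7, 5, 1], [5, 2, 3, 0, 6, 1, 4, 7, 8, 7, 1, 2, 9, 4, 0, 8, 6, 9, 4, 0, 3, 1, 8, 6,
  8, 5, 7, 4, 0, 2, 2, 8, 6, 5, 3, 9, 9, 0, 3, 4, 5, 6, 4, 7, 2, 1, 7, 9, 0, 2, 5, 1, 7, 8,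
  5, 3, 1], [1, 7, 3, 2, 6, 5, 0, 4, 8, 6, 8, 9, 2, 5, 0, 4, 7, 0, 4, 8, 2, 3, 5, 9, 6, 9, 1,
  7, 2, 4, 1, 3, 5, 0, 8, 9, 7, 4, 8, 5, 1, 0, 6, 7, 7, 4, 3, 9, 3, 2, 2, 6, 8, 5, 1, 0, 1],
  [7, 1, 3, 5, 6, 0, 2, 4, 8, 5, 6, 3, 0, 8, 2, 9, 4, 8, 7, 9, 6, 0, 2, 3, 2, 5, 1, 0, 9, 4,
  4, 9, 8, 0, 6, 3, 7, 8, 2, 4, 2, 5, 6, 3, 1, 8, 1, 0, 7, 3, 7, 5, 6, 7, 9, 5, 1], [6, 2, 3,
  1, 5, 0, 4, 7, 8, 1, 5, 9, 3, 8, 2, 4, 0, 0, 7, 6, 8, 3, 5, 4, 6, 2, 1, 4, 8, 7, 4, 3, 5,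
  2, 8, 7, 1, 0, 9, 2, 5, 3, 4, 1, 9, 7, 0, 0, 6, 3, 6, 1, 5, 2, 7, 6, 9], [1, 6, 5, 0, 3, 2,
  7, 4, 2, 4, 5, 6, 7, 0, 3, 5, 7, 0, 4, 2, 6, 3, 7, 3, 0, 4, 1, 2, 3, 1, 0, 5, 6, 3, 2, 1,
  7, 1, 4, 1, 5, 6, 4, 2, 7, 5, 6, 0]]"

text \<open>The system for circles through both infinity and zero.\<close>

definition quads3 :: "pt list list" where
  "quads3 = pair_quads @
  [[A0, A1, A2, A9], [A0, A1, A3, A5], [A0, A1, A4, B9], [A0, A1, A6, A8], [A0, A1, A7, B6],
  [A0, A1, B2, B8], [A0, A1, B3, B5], [A0, A1, B4, B7], [A0, A2, A3, B9], [A0, A2, A4, A5],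
  [A0, A2, A6, B8], [A0, A2, A7, A8], [A0, A2, B1, B7], [A0, A2, B3, B6], [A0, A2, B4, B5],
  [A0, A3, A4, A8], [A0, A3, A6, B7], [A0, A3, A7, B2], [A0, A3, A9, B4], [A0, A3, B1, B5],
  [A0, A3, B6, B8], [A0, A4, A6, A9], [A0, A4, A7, B3], [A0, A4, B1, B6], [A0, A4, B2, B5],
  [A0, A4, B7, B8], [A0, A5, A6, A7], [A0, A5, A8, A9], [A0, A5, B1, B3], [A0, A5, B2, B4],
  [A0, A5, B6, B7], [A0, A5, B8, B9], [A0, A6, B1, B2], [A0, A6, B3, B4], [A0, A6, B5, B9],
  [A0, A7, A9, B1], [A0, A7, B4, B9], [A0, A7, B5, B8], [A0, A8, B1, B9], [A0, A8, B2, B3],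
  [A0, A8, B4, B6], [A0, A8, B5, B7], [A0, A9, B2, B7], [A0, A9, B3, B8], [A0, A9, B5, B6],
  [A0, B1, B4, B8], [A0, B2, B6, B9], [A0, B3, B7, B9], [A1, A2, A3, A4], [A1, A2, A5, B9],
  [A1, A2, A6, A7], [A1, A2, A8, B7], [A1, A2, B0, B6], [A1, A2, B3, B4], [A1, A2, B5, B8],
  [A1, A3, A6, A9], [A1, A3, A7, A8], [A1, A3, B0, B5], [A1, A3, B2, B4], [A1, A3, B6, B9],
  [A1, A3, B7, B8], [A1, A4, A5, A6], [A1, A4, A7, B8], [A1, A4, A8, B0], [A1, A4, A9, B5],
  [A1, A4, B2, B3], [A1, A4, B6, B7], [A1, A5, A7, A9], [A1, A5, A8, B4], [A1, A5, B0, B3],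
  [A1, A5, B2, B7], [A1, A5, B6, B8], [A1, A6, B0, B4], [A1, A6, B2, B9], [A1, A6, B3, B8],
  [A1, A6, B5, B7], [A1, A7, B0, B2], [A1, A7, B3, B9], [A1, A7, B4, B5], [A1, A8, A9, B2],
  [A1, A8, B3, B6], [A1, A8, B5, B9], [A1, A9, B0, B8], [A1, A9, B3, B7], [A1, A9, B4, B6],
  [A1, B0, B7, B9], [A1, B2, B5, B6], [A1, B4, B8, B9], [A2, A3, A5, A7], [A2, A3, A6, B5],
  [A2, A3, A8, A9], [A2, A3, B0, B8], [A2, A3, B1, B4], [A2, A3, B6, B7], [A2, A4, A6, A8],
  [A2, A4, A7, A9], [A2, A4, B0, B5], [A2, A4, B1, B3], [A2, A4, B6, B8], [A2, A4, B7, B9],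
  [A2, A5, A6, B1], [A2, A5, A8, B6], [A2, A5, A9, B3], [A2, A5, B0, B4], [A2, A5, B7, B8],
  [A2, A6, A9, B0], [A2, A6, B3, B9], [A2, A6, B4, B7], [A2, A7, B0, B9], [A2, A7, B1, B5],
  [A2, A7, B3, B8], [A2, A7, B4, B6], [A2, A8, B0, B1], [A2, A8, B3, B5], [A2, A8, B4, B9],
  [A2, A9, B1, B6], [A2, A9, B4, B8], [A2, A9, B5, B7], [A2, B0, B3, B7], [A2, B1, B8, B9],
  [A2, B5, B6, B9], [A3, A4, A5, A9], [A3, A4, A6, A7], [A3, A4, B0, B6], [A3, A4, B1, B2],
  [A3, A4, B5, B7], [A3, A4, B8, B9], [A3, A5, A6, A8], [A3, A5, B0, B1], [A3, A5, B2, B8],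
  [A3, A5, B4, B6], [A3, A5, B7, B9], [A3, A6, B0, B2], [A3, A6, B1, B8], [A3, A6, B4, B9],
  [A3, A7, A9, B0], [A3, A7, B1, B9], [A3, A7, B4, B8], [A3, A7, B5, B6], [A3, A8, B0, B9],
  [A3, A8, B1, B6], [A3, A8, B2, B7], [A3, A8, B4, B5], [A3, A9, B1, B7], [A3, A9, B2, B6],
  [A3, A9, B5, B8], [A3, B0, B4, B7], [A3, B2, B5, B9], [A4, A5, A7, A8], [A4, A5, B0, B2],
  [A4, A5, B1, B7], [A4, A5, B3, B8], [A4, A5, B6, B9], [A4, A6, B0, B8], [A4, A6, B1, B9],
  [A4, A6, B2, B7], [A4, A6, B3, B5], [A4, A7, B0, B1], [A4, A7, B2, B6], [A4, A7, B5, B9],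
  [A4, A8, A9, B1], [A4, A8, B2, B9], [A4, A8, B3, B7], [A4, A8, B5, B6], [A4, A9, B0, B7],
  [A4, A9, B2, B8], [A4, A9, B3, B6], [A4, B0, B3, B9], [A4, B1, B5, B8], [A5, A6, A9, B2],
  [A5, A6, B0, B9], [A5, A6, B3, B7], [A5, A6, B4, B8], [A5, A7, B0, B8], [A5, A7, B1, B6],
  [A5, A7, B2, B9], [A5, A7, B3, B4], [A5, A8, B0, B7], [A5, A8, B1, B2], [A5, A8, B3, B9],
  [A5, A9, B0, B6], [A5, A9, B1, B8], [A5, A9, B4, B7], [A5, B1, B4, B9], [A5, B2, B3, B6],
  [A6, A7, A8, A9], [A6, A7, B0, B5], [A6, A7, B1, B4], [A6, A7, B2, B3], [A6, A7, B8, B9],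
  [A6, A8, B0, B3], [A6, A8, B1, B5], [A6, A8, B2, B4], [A6, A8, B7, B9], [A6, A9, B1, B3],
  [A6, A9, B4, B5], [A6, A9, B7, B8], [A6, B0, B1, B7], [A6, B2, B5, B8], [A7, A8, B0, B4],
  [A7, A8, B1, B3], [A7, A8, B2, B5], [A7, A8, B6, B9], [A7, A9, B2, B4], [A7, A9, B3, B5],
  [A7, A9, B6, B8], [A7, B0, B3, B6], [A7, B1, B2, B8], [A8, A9, B0, B5], [A8, A9, B3, B4],
  [A8, A9, B6, B7], [A8, B0, B2, B6], [A8, B1, B4, B7], [A9, B0, B1, B4], [A9, B0, B2, B3],
  [A9, B1, B2, B5], [B0, B1, B2, B9], [B0, B1, B3, B5], [B0, B1, B6, B8], [B0, B2, B4, B5],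
  [B0, B2, B7, B8], [B0, B3, B4, B8], [B0, B4, B6, B9], [B0, B5, B6, B7], [B0, B5, B8, B9],
  [B1, B2, B3, B4], [B1, B2, B6, B7], [B1, B3, B6, B9], [B1, B3, B7, B8], [B1, B4, B5, B6],
  [B1, B5, B7, B9], [B2, B3, B5, B7], [B2, B3, B8, B9], [B2, B4, B6, B8], [B2, B4, B7, B9],
  [B3, B4, B5, B9], [B3, B4, B6, B7], [B3, B5, B6, B8], [B4, B5, B7, B8], [B6, B7, B8, B9]]"

definition colours3 :: "nat list list" where
  "colours3 =
  [[3, 1, 7, 2, 6, 5, 0, 4, 8, 6, 1, 5, 8, 2, 9, 0, 7, 4, 3, 2, 7, 5, 9, 8, 9, 6, 8, 5, 2, 0,
  0, 6, 1, 4, 8, 9, 2, 8, 0, 4, 7, 7, 4, 3, 4, 1, 5, 0, 5, 3, 1, 3, 1, 7, 6, 6, 2], [0, 5, 4,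
  7, 2, 6, 1, 3, 8, 6, 5, 1, 9, 8, 4, 3, 2, 2, 3, 4, 7, 9, 1, 8, 3, 0, 1, 6, 7, 9, 0, 6, 5,
  4, 9, 3, 7, 4, 6, 8, 1, 8, 2, 7, 5, 3, 5, 9, 1, 2, 6, 2, 0, 5, 4, 0, 0], [6, 4, 1, 2, 5, 7,
  3, 0, 8, 3, 2, 1, 4, 5, 9, 8, 7, 6, 0, 9, 1, 2, 5, 8, 8, 0, 7, 5, 3, 4, 3, 0, 4, 7, 9, 5,
  2, 6, 4, 9, 7, 1, 6, 8, 7, 6, 2, 1, 8, 9, 4, 5, 6, 2, 0, 1, 3], [2, 3, 7, 4, 0, 1, 5, 6, 8,
  4, 3, 9, 8, 6, 1, 5, 0, 2, 7, 1, 8, 0, 6, 9, 8, 6, 5, 1, 9, 4, 6, 0, 5, 1, 3, 7, 3, 7, 5,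
  2, 1, 9, 4, 5, 4, 2, 3, 9, 0, 8, 2, 7, 0, 3, 2, 6, 4], [7, 1, 0, 5, 4, 2, 6, 3, 8, 2, 1, 0,
  3, 8, 9, 6, 4, 4, 5, 0, 6, 7, 3, 8, 8, 2, 9, 7, 6, 5, 6, 9, 3, 2, 1, 7, 7, 8, 3, 9, 0, 1,
  6, 7, 0, 5, 4, 3, 4, 1, 2, 5, 0, 5, 1, 4, 8], [2, 0, 3, 1, 5, 6, 4, 7, 8, 3, 9, 7, 4, 6, 1,
  0, 5, 7, 2, 1, 6, 5, 8, 4, 5, 1, 2, 0, 8, 6, 6, 8, 7, 0, 9, 2, 0, 4, 3, 8, 1, 5, 0, 9, 3,
  9, 8, 6, 2, 1, 9, 3, 3, 2, 7, 4, 7], [0, 5, 3, 7, 2, 1, 6, 4, 8, 2, 5, 8, 3, 7, 9, 6, 4, 0,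
  1, 4, 3, 7, 8, 9, 2, 7, 8, 6, 1, 4, 9, 6, 4, 0, 5, 1, 6, 5, 0, 0, 2, 3, 9, 5, 8, 1, 2, 3,
  9, 3, 8, 0, 4, 7, 2, 7, 6], [2, 7, 4, 6, 0, 3, 1, 5, 8, 6, 9, 7, 5, 4, 0, 3, 1, 3, 0, 8, 5,
  1, 2, 9, 2, 1, 5, 6, 0, 7, 9, 3, 1, 4, 5, 6, 4, 3, 7, 7, 8, 0, 1, 7, 0, 5, 8, 6, 8, 3, 2,
  4, 6, 4, 2, 9, 9], [4, 0, 1, 7, 5, 2, 3, 6, 8, 9, 2, 0, 7, 1, 5, 6, 8, 7, 3, 6, 8, 4, 2, 5,
  6, 8, 0, 9, 4, 3, 4, 2, 5, 9, 1, 1, 2, 7, 3, 9, 5, 3, 6, 5, 1, 6, 2, 0, 7, 8, 0, 4, 3, 0,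
  1, 8, 4], [8, 2, 4, 6, 5, 7, 1, 3, 0, 7, 1, 2, 4, 5, 6, 3, 0, 9, 6, 8, 1, 4, 0, 3, 2, 0, 5,
  3, 8, 6, 9, 3, 7, 4, 5, 8, 9, 1, 7, 4, 0, 6, 1, 2, 6, 7, 4, 5, 9, 1, 2, 5, 8, 7, 0, 2, 3],
  [6, 0, 3, 1, 4, 2, 5, 7, 8, 5, 0, 8, 9, 7, 1, 4, 3, 8, 2, 3, 6, 7, 9, 4, 9, 7, 4, 2, 1, 6,
  5, 3, 4, 0, 6, 0, 6, 2, 1, 9, 5, 8, 0, 8, 3, 6, 5, 7, 2, 1, 0, 8, 9, 2, 4, 7, 5], [6, 2, 3,
  1, 5, 0, 4, 7, 8, 0, 9, 3, 4, 8, 5, 1, 2, 8, 9, 7, 1, 3, 6, 5, 6, 1, 4, 0, 5, 2, 8, 2, 7,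
  4, 0, 2, 0, 3, 6, 3, 6, 1, 5, 8, 9, 9, 0, 7, 4, 2, 8, 5, 1, 7, 6, 4, 3], [0, 7, 3, 6, 2, 1,
  4, 5, 8, 8, 5, 9, 7, 6, 2, 1, 3, 1, 4, 0, 2, 9, 3, 6, 2, 9, 8, 6, 0, 7, 1, 3, 8, 0, 7, 4,
  6, 8, 5, 7, 9, 0, 1, 2, 3, 7, 6, 5, 4, 3, 2, 0, 9, 8, 1, 4, 5], [2, 6, 0, 3, 1, 5, 4, 7, 8,
  7, 1, 8, 0, 4, 9, 5, 3, 8, 5, 4, 0, 1, 3, 2, 9, 3, 6, 2, 4, 5, 6, 2, 1, 4, 0, 9, 7, 2, 8,
  3, 8, 1, 5, 0, 6, 6, 7, 3, 1, 2, 7, 8, 6, 4, 5, 0, 9], [4, 2, 3, 6, 7, 5, 0, 1, 8, 8, 0, 5,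
  1, 2, 3, 9, 7, 5, 7, 0, 9, 4, 1, 6, 9, 6, 7, 8, 2, 4, 3, 0, 2, 8, 1, 8, 9, 2, 4, 1, 4, 3,
  5, 6, 7, 3, 0, 2, 3, 7, 8, 6, 0, 5, 1, 4, 9], [7, 2, 3, 0, 1, 4, 5, 6, 8, 8, 5, 6, 4, 1, 0,
  2, 3, 1, 9, 0, 3, 4, 7, 6, 8, 2, 9, 4, 6, 0, 7, 1, 3, 4, 2, 5, 3, 9, 8, 6, 0, 2, 7, 8, 7,
  1, 5, 3, 0, 8, 5, 7, 4, 1, 6, 2, 9], [6, 3, 0, 4, 7, 5, 1, 2, 8, 7, 8, 9, 5, 0, 4, 1, 3, 4,
  6, 9, 8, 5, 0, 2, 2, 1, 9, 5, 6, 7, 0, 1, 3, 8, 5, 4, 8, 6, 2, 2, 3, 7, 0, 4, 9, 7, 1, 7,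
  2, 8, 4, 1, 9, 6, 3, 0, 5], [0, 5, 7, 2, 1, 4, 3, 6, 8, 8, 1, 9, 3, 6, 2, 5, 4, 4, 0, 9, 2,
  1, 6, 7, 8, 5, 9, 2, 0, 3, 6, 1, 3, 7, 4, 0, 8, 7, 2, 5, 8, 3, 0, 4, 6, 1, 9, 1, 5, 4, 8,
  3, 9, 6, 0, 7, 2], [2, 0, 7, 4, 1, 6, 3, 5, 8, 5, 9, 0, 8, 1, 4, 6, 7, 2, 6, 9, 8, 7, 3, 4,
  1, 4, 0, 8, 5, 6, 2, 9, 5, 3, 7, 5, 6, 0, 3, 2, 7, 4, 0, 1, 8, 2, 1, 9, 4, 0, 5, 2, 3, 6,
  1, 9, 7], [8, 1, 7, 6, 0, 5, 2, 3, 4, 4, 1, 0, 6, 2, 7, 3, 5, 3, 5, 9, 7, 2, 0, 8, 8, 0, 6,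
  5, 2, 4, 9, 2, 7, 4, 3, 0, 7, 3, 1, 6, 2, 4, 8, 9, 6, 5, 1, 0, 5, 1, 7, 8, 9, 1, 4, 3, 6]]"

section \<open>Evaluation of the checks for the three systems\<close>

lemma quads_check_1: "quads_check quads1"
  by code_simp

lemma point_check_1: "list_all (point_check quads1) points"
  by code_simp

text \<open>On a circle that misses infinity no point has its partner on the circle, so
  resolvability is required at every point.\<close>

lemma colour_check_1:
  "list_all2 (\<lambda>p cs. resolvable_check quads1 cs p) points colours1"
  by code_simp

lemma covered_1: "covered quads1 p"
  using point_check_1 set_points covered_check[OF quads_check_1] by (auto simp: list_all_iff)

lemma SQS_1: "SQS 20 UNIV (system quads1)"
  by (rule SQS_system[OF quads_check_1]) (rule covered_1)

lemma pairs_1: "q \<noteq> p \<Longrightarrow> q \<noteq> flip p \<Longrightarrow> {p, flip p, q, flip q} \<in> system quads1"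
  using covered_1[of p] unfolding covered_def[OF quads_check_1] by simp

lemma quads_check_2: "quads_check quads2"
  by code_simp

lemma point_check_2: "list_all (point_check quads2) points"
  by code_simp

text \<open>\<open>A9\<close> and \<open>B9\<close> lie over infinity, whose partner zero is off the
  circle. All other points have the partner infinity, which is on it and represented by
  \<open>A9\<close>.\<close>

lemma colour_check_2:
  "list_all2 (\<lambda>p cs. if p = A9 \<or> p = B9 then resolvable_check quads2 cs p
     else hanani_check quads2 cs p A9) points colours2"
  by code_simp

lemma covered_2: "covered quads2 p"
  using point_check_2 set_points covered_check[OF quads_check_2] by (auto simp: list_all_iff)

lemma SQS_2: "SQS 20 UNIV (system quads2)"
  by (rule SQS_system[OF quads_check_2]) (rule covered_2)

lemma pairs_2: "q \<noteq> p \<Longrightarrow> q \<noteq> flip p \<Longrightarrow> {p, flip p, q, flip q} \<in> system quads2"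
  using covered_2[of p] unfolding covered_def[OF quads_check_2] by simp

lemma quads_check_3: "quads_check quads3"
  by code_simp

lemma point_check_3: "list_all (point_check quads3) points"
  by code_simp

text \<open>Every point now has its partner on the circle: zero, represented by \<open>A0\<close>,
  for the points over infinity, and infinity, represented by \<open>A9\<close>, for all
  others.\<close>

lemma colour_check_3:
  "list_all2 (\<lambda>p cs. hanani_check quads3 cs p (if p = A9 \<or> p = B9 then A0 else A9)) points colours3"
  by code_simp

lemma covered_3: "covered quads3 p"
  using point_check_3 set_points covered_check[OF quads_check_3] by (auto simp: list_all_iff)

lemma SQS_3: "SQS 20 UNIV (system quads3)"
  by (rule SQS_system[OF quads_check_3]) (rule covered_3)

lemma pairs_3: "q \<noteq> p \<Longrightarrow> q \<noteq> flip p \<Longrightarrow> {p, flip p, q, flip q} \<in> system quads3"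
  using covered_3[of p] unfolding covered_def[OF quads_check_3] by simp

lemma list_all2_ex:
  assumes "list_all2 R points css"
  shows "\<exists>cs. R p cs"
  using assms set_points[of p] unfolding list_all2_conv_all_nth in_set_conv_nth by metis

lemma resolvable_1: "resolvable_at (system quads1) p (flip p)"
  using list_all2_ex[OF colour_check_1, of p] resolvable_system[OF quads_check_1] by blast

lemma resolvable_2: "resolvable_at (system quads2) A9 (flip A9)" "resolvable_at (system quads2) B9 (flip B9)"
proof -
  obtain cs where "resolvable_check quads2 cs A9"
    using list_all2_ex[OF colour_check_2, of A9] by auto
  thus "resolvable_at (system quads2) A9 (flip A9)" by (rule resolvable_system[OF quads_check_2])
  obtain cs where "resolvable_check quads2 cs B9"
    using list_all2_ex[OF colour_check_2, of B9] by auto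
  thus "resolvable_at (system quads2) B9 (flip B9)" by (rule resolvable_system[OF quads_check_2])
qed

lemma hanani_2:
  assumes "p \<noteq> A9" "p \<noteq> B9"
  shows "hanani_at (system quads2) p {flip p, A9, flip A9}"
proof -
  obtain cs where "hanani_check quads2 cs p A9"
    using list_all2_ex[OF colour_check_2, of p] assms by auto
  moreover have "A9 \<noteq> flip p" using assms by (cases p) simp_all
  ultimately show ?thesis using assms by (intro hanani_system[OF quads_check_2]) simp_all
qed

lemma hanani_3:
  assumes "p \<noteq> A9" "p \<noteq> B9"
  shows "hanani_at (system quads3) p {flip p, A9, flip A9}"
proof -
  obtain cs where "hanani_check quads3 cs p A9"
    using list_all2_ex[OF colour_check_3, of p] assms by auto
  moreover have "A9 \<noteq> flip p" using assms by (cases p) simp_all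
  ultimately show ?thesis using assms by (intro hanani_system[OF quads_check_3]) simp_all
qed

lemma hanani_3_infinity:
  "hanani_at (system quads3) A9 {flip A9, A0, flip A0}" "hanani_at (system quads3) B9 {flip B9, A0, flip A0}"
proof -
  obtain cs where "hanani_check quads3 cs A9 A0"
    using list_all2_ex[OF colour_check_3, of A9] by auto
  thus "hanani_at (system quads3) A9 {flip A9, A0, flip A0}"
    by (rule hanani_system[OF quads_check_3]) simp_all
  obtain cs where "hanani_check quads3 cs B9 A0"
    using list_all2_ex[OF colour_check_3, of B9] by auto
  thus "hanani_at (system quads3) B9 {flip B9, A0, flip A0}"
    by (rule hanani_system[OF quads_check_3]) simp_all
qed

section \<open>The construction\<close>

fun coord :: "pt \<Rightarrow> nat" where
  "coord A0 = 0" | "coord A1 = 1" | "coord A2 = 2" | "coord A3 = 3" | "coord A4 = 4"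
| "coord A5 = 5" | "coord A6 = 6" | "coord A7 = 7" | "coord A8 = 8" | "coord A9 = 9"
| "coord B0 = 0" | "coord B1 = 1" | "coord B2 = 2" | "coord B3 = 3" | "coord B4 = 4"
| "coord B5 = 5" | "coord B6 = 6" | "coord B7 = 7" | "coord B8 = 8" | "coord B9 = 9"

definition level :: "pt \<Rightarrow> bool" where
  "level p \<longleftrightarrow> p \<in> {B0, B1, B2, B3, B4, B5, B6, B7, B8, B9}"

definition point_at :: "nat \<Rightarrow> bool \<Rightarrow> pt" where
  "point_at j i = (if i then [B0, B1, B2, B3, B4, B5, B6, B7, B8, B9] ! j
     else [A0, A1, A2, A3, A4, A5, A6, A7, A8, A9] ! j)"

lemma coord_less: "coord p < 10"
  by (cases p) simp_all

lemma point_at_coord_level: "point_at (coord p) (level p) = p"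
  by (cases p) (simp_all add: point_at_def level_def)

lemma coord_level_point_at:
  assumes "j < 10"
  shows "coord (point_at j i) = j \<and> level (point_at j i) = i"
proof -
  have "j \<in> {0, 1, 2, 3, 4, 5, 6, 7, 8, 9}" using assms by auto
  thus ?thesis by (auto simp: point_at_def level_def)
qed

lemma coord_flip: "coord (flip p) = coord p" and level_flip: "level (flip p) \<longleftrightarrow> \<not> level p"
  by (cases p; simp add: level_def)+

text \<open>An enumeration \<open>h\<close> of a circle identifies the 20 abstract points with the
  points over the circle, and \<open>flip\<close> with the exchange of the two points of a
  fibre.\<close>

definition label :: "(nat \<Rightarrow> 'p) \<Rightarrow> pt \<Rightarrow> 'p \<times> bool" where
  "label h p = (h (coord p), level p)"

lemma label_flip: "label h (flip p) = (h (coord p), \<not> level p)"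
  by (simp add: label_def coord_flip level_flip)

lemma label_fiber: "{label h p, label h (flip p)} = fiber (h (coord p))"
  unfolding label_flip by (cases "level p") (auto simp: label_def)

context
  fixes h :: "nat \<Rightarrow> 'p" and C :: "'p set" and S :: "pt set set"
  assumes h: "bij_betw h {..<10} C" and S: "SQS 20 UNIV S"
begin

definition transported :: "('p \<times> bool) set set" where
  "transported = (`) (label h) ` S"

lemma label_point_at: "j < 10 \<Longrightarrow> label h (point_at j i) = (h j, i)"
  using coord_level_point_at by (simp add: label_def)

lemma inj_label: "inj (label h)"
proof (rule injI)
  fix p q assume "label h p = label h q"
  hence eq: "h (coord p) = h (coord q)" "level p = level q" by (simp_all add: label_def)
  have "coord p = coord q"
    using bij_betw_imp_inj_on[OF h] eq(1) by (rule inj_onD) (simp_all add: coord_less)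
  hence "point_at (coord p) (level p) = point_at (coord q) (level q)" using eq(2) by simp
  thus "p = q" unfolding point_at_coord_level .
qed

lemma range_label: "range (label h) = C \<times> UNIV"
proof (intro equalityI subsetI)
  fix z assume "z \<in> range (label h)"
  thus "z \<in> C \<times> UNIV" using bij_betwE[OF h] coord_less by (auto simp: label_def)
next
  fix z assume "z \<in> C \<times> (UNIV :: bool set)"
  then obtain x i where z: "z = (x, i)" "x \<in> C" by auto
  then obtain j where "j < 10" "x = h j" using bij_betw_imp_surj_on[OF h] by blast
  hence "z = label h (point_at j i)" using label_point_at z(1) by simp
  thus "z \<in> range (label h)" by blast
qed

lemma SQS_transported: "SQS 20 (C \<times> UNIV) transported"
  using SQS_image[OF S inj_label] unfolding transported_def range_label .

lemma transported_pairs: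
  assumes "\<And>p q. q \<noteq> p \<Longrightarrow> q \<noteq> flip p \<Longrightarrow> {p, flip p, q, flip q} \<in> S"
    and "x \<in> C" "z \<in> C" "x \<noteq> z"
  shows "fiber x \<union> fiber z \<in> transported"
proof -
  obtain j where j: "j < 10" "x = h j" using assms(2) bij_betw_imp_surj_on[OF h] by blast
  obtain k where k: "k < 10" "z = h k" using assms(3) bij_betw_imp_surj_on[OF h] by blast
  let ?p = "point_at j False" and ?q = "point_at k False"
  have ix: "coord ?p = j" "coord ?q = k" using coord_level_point_at j(1) k(1) by auto
  have "j \<noteq> k" using j(2) k(2) assms(4) by blast
  \<comment> \<open>\<open>flip\<close> preserves the index, so different indices exclude both
    equalities.\<close>
  hence "?q \<noteq> ?p" "?q \<noteq> flip ?p" using ix coord_flip[of ?p] by metis+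
  hence "label h ` {?p, flip ?p, ?q, flip ?q} \<in> transported"
    using assms(1) unfolding transported_def by blast
  moreover have "label h ` {?p, flip ?p, ?q, flip ?q} = {label h ?p, label h (flip ?p)} \<union> {label h ?q, label h (flip ?q)}"
    by auto
  ultimately show ?thesis unfolding label_fiber ix j(2) k(2) by simp
qed

lemma transported_resolvable:
  assumes "resolvable_at S p (flip p)"
  shows "resolvable_at transported (h (coord p), level p) (h (coord p), \<not> level p)"
  using resolvable_at_image[OF assms inj_label] unfolding transported_def label_flip[symmetric]
  by (simp add: label_def[symmetric])

lemma transported_hanani:
  assumes "hanani_at S p {flip p, r, flip r}"
  shows "hanani_at transported (h (coord p), level p) (insert (h (coord p), \<not> level p) (fiber (h (coord r))))"
proof -
  have "label h ` {flip p, r, flip r} = insert (label h (flip p)) {label h r, label h (flip r)}" by auto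
  hence "label h ` {flip p, r, flip r} = insert (h (coord p), \<not> level p) (fiber (h (coord r)))"
    unfolding label_fiber label_flip[of h p] .
  thus ?thesis
    using hanani_at_image[OF assms inj_label] unfolding transported_def
    by (simp add: label_def[symmetric])
qed

end

lemma ex_bij_last:
  assumes "card C = 10" "c \<in> C"
  obtains h :: "nat \<Rightarrow> 'p" where "bij_betw h {..<10} C" "h 9 = c"
proof -
  have fin: "finite C" using assms(1) by (intro card_ge_0_finite) simp
  then obtain xs where xs: "set xs = C - {c}" "distinct xs" using finite_distinct_list by blast
  have len: "length xs = 9" using xs assms fin distinct_card[OF xs(2)] by simp
  have "bij_betw ((!) (xs @ [c])) {..<10} C"
    by (rule bij_betw_nth) (use xs len assms(2) in auto)
  moreover have "(xs @ [c]) ! 9 = c" using len by (simp add: nth_append)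
  ultimately show ?thesis using that by blast
qed

text \<open>Used with infinity at index 9 and zero at index 0, the positions presupposed by the
  third colour table.\<close>

lemma ex_bij_first_last:
  assumes "card C = 10" "c \<in> C" "d \<in> C" "c \<noteq> d"
  obtains h :: "nat \<Rightarrow> 'p" where "bij_betw h {..<10} C" "h 9 = c" "h 0 = d"
proof -
  have fin: "finite C" using assms(1) by (intro card_ge_0_finite) simp
  have "finite (C - {c, d})" by (rule finite_Diff[OF fin])
  from finite_distinct_list[OF this] obtain xs where xs: "set xs = C - {c, d}" "distinct xs" by blast
  have "card (C - {c, d}) = card C - card {c, d}"
    by (rule card_Diff_subset) (use assms in simp_all)
  also have "\<dots> = 8" using assms(1,4) by simp
  finally have "card (C - {c, d}) = 8" .
  hence len: "length xs = 8" using distinct_card[OF xs(2)] unfolding xs(1) by simp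
  have "bij_betw ((!) (d # xs @ [c])) {..<10} C"
    by (rule bij_betw_nth) (use xs len assms(2-4) in auto)
  moreover have "(d # xs @ [c]) ! 9 = c" using len by (simp add: nth_append)
  ultimately show ?thesis using that[of "(!) (d # xs @ [c])"] by simp
qed

section \<open>One system for every circle\<close>

context subfield_pair
begin

text \<open>Which points have their partner on the circle depends only on whether infinity and zero
  lie on it, so three systems cover all circles.\<close>

lemma circle_system:
  assumes C: "C \<in> circles"
  shows "\<exists>T. SQS 20 (C \<times> UNIV) T \<and> (\<forall>x\<in>C. \<forall>z\<in>C. x \<noteq> z \<longrightarrow> fiber x \<union> fiber z \<in> T) \<and>
    (\<forall>x\<in>C. \<forall>i. partner x \<notin> C \<longrightarrow> resolvable_at T (x, i) (x, \<not> i)) \<and>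
    (\<forall>x\<in>C. \<forall>i. partner x \<in> C \<longrightarrow>
      hanani_at T (x, i) (insert (x, \<not> i) (fiber (partner x))))"
proof -
  have card: "card C = 10" using circle_card[OF C] by simp
  have at_point: "\<exists>p. coord p < 10 \<and> x = h (coord p) \<and> level p = i"
    if h: "bij_betw h {..<10} C" and x: "x \<in> C" for h x i
  proof -
    obtain j where "j < 10" "x = h j" using x bij_betw_imp_surj_on[OF h] by blast
    thus ?thesis using coord_level_point_at[of j i] by (intro exI[of _ "point_at j i"]) simp
  qed
  show ?thesis
  proof (cases "None \<in> C")
    case False
    \<comment> \<open>Any enumeration serves, since the first system is resolvable at every
      point.\<close>
    obtain h :: "nat \<Rightarrow> 'a option" where h: "bij_betw h {..<10} C"
      using card ex_bij_last[of C] by (metis card.empty ex_in_conv zero_neq_numeral)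
    have x: "partner x = None" if "x \<in> C" for x
      using False that by (cases x) (auto simp: partner_def)
    have "resolvable_at (transported h (system quads1)) (x, i) (x, \<not> i)" if "x \<in> C" for x i
      using at_point[OF h that, of i] transported_resolvable[OF h SQS_1 resolvable_1] by blast
    thus ?thesis
      using SQS_transported[OF h SQS_1] transported_pairs[OF h SQS_1 pairs_1] x False
      by (intro exI[of _ "transported h (system quads1)"]) simp
  next
    case None: True
    have finite_point: "\<exists>p. p \<noteq> A9 \<and> p \<noteq> B9 \<and> x = h (coord p) \<and> level p = i"
      if hx: "bij_betw h {..<10} C" "h 9 = None" "x \<in> C" "x \<noteq> None" for h x i
    proof -
      obtain p where p: "x = h (coord p)" "level p = i" using at_point[OF hx(1,3)] by blast
      have "p \<noteq> A9" "p \<noteq> B9" using p(1) hx(2,4) by auto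
      thus ?thesis using p by blast
    qed
    show ?thesis
    proof (cases "Some 0 \<in> C")
      case False
      obtain h :: "nat \<Rightarrow> 'a option" where h: "bij_betw h {..<10} C" "h 9 = None"
        using ex_bij_last[OF card None] .
      let ?T = "transported h (system quads2)"
      have "resolvable_at ?T (x, i) (x, \<not> i)" if "x \<in> C" "partner x \<notin> C" for x i
      proof -
        \<comment> \<open>Finite points have infinity as their partner, which lies on the circle, so
          only infinity itself is left.\<close>
        have x: "x = None" using that None by (cases x) (auto simp: partner_def)
        show ?thesis
          using transported_resolvable[OF h(1) SQS_2, of A9] transported_resolvable[OF h(1) SQS_2, of B9]
            resolvable_2 h(2) x by (cases i) (simp_all add: level_def)
      qed
      moreover have "hanani_at ?T (x, i) (insert (x, \<not> i) (fiber (partner x)))"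
        if xC: "x \<in> C" "partner x \<in> C" for x i
      proof -
        have x: "x \<noteq> None" "partner x = None"
          using xC(2) False by (cases x; simp add: partner_def)+
        obtain p where p: "p \<noteq> A9" "p \<noteq> B9" "x = h (coord p)" "level p = i"
          using finite_point[OF h xC(1) x(1)] by blast
        show ?thesis
          using transported_hanani[OF h(1) SQS_2, of p A9] hanani_2[OF p(1,2)] h(2) x(2) p(3,4) by simp
      qed
      ultimately show ?thesis
        using SQS_transported[OF h(1) SQS_2] transported_pairs[OF h(1) SQS_2 pairs_2]
        by (intro exI[of _ ?T]) simp
    next
      case True
      obtain h :: "nat \<Rightarrow> 'a option" where h: "bij_betw h {..<10} C" "h 9 = None" "h 0 = Some 0"
        using ex_bij_first_last[OF card None True] by blast
      let ?T = "transported h (system quads3)"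
      have "hanani_at ?T (x, i) (insert (x, \<not> i) (fiber (partner x)))" if xC: "x \<in> C" for x i
      proof (cases "x = None")
        case True
        thus ?thesis
          using transported_hanani[OF h(1) SQS_3, of A9 A0] transported_hanani[OF h(1) SQS_3, of B9 A0]
            hanani_3_infinity h(2,3) by (cases i) (simp_all add: level_def partner_def)
      next
        case x: False
        hence "partner x = None" by (auto simp: partner_def split: option.splits)
        moreover obtain p where p: "p \<noteq> A9" "p \<noteq> B9" "x = h (coord p)" "level p = i"
          using finite_point[OF h(1,2) xC x] by blast
        ultimately show ?thesis
          using transported_hanani[OF h(1) SQS_3, of p A9] hanani_3[OF p(1,2)] h(2) p(3,4) by simp
      qed
      moreover have "partner x \<in> C" for x
        using None True by (cases x) (simp_all add: partner_def)
      ultimately show ?thesis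
        using SQS_transported[OF h(1) SQS_3] transported_pairs[OF h(1) SQS_3 pairs_3]
        by (intro exI[of _ ?T]) simp
    qed
  qed
qed

end

theorem theorem3p9:
  fixes n :: nat
  assumes "n \<ge> 1"
  shows "\<exists>(X :: nat set) B. mcDSQS (2 * 9 ^ n + 2) X B"
proof -
  interpret subfield_pair "frobenius_fixed (9 ^ n)" "frobenius_fixed 9"
    by (rule subfield_pair_frobenius_fixed[OF assms])
  have card: "card proj = 9 ^ n + 1"
    using card_proj card_frobenius_fixed[of "2 * n"] assms by (simp add: power_mult)
  \<comment> \<open>One system is fixed for each circle; it has to serve all points of that circle
    at once.\<close>
  from bchoice[OF ballI[OF circle_system]] obtain S where S: "\<forall>C\<in>circles. SQS 20 (C \<times> UNIV) (S C) \<and>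
    (\<forall>x\<in>C. \<forall>z\<in>C. x \<noteq> z \<longrightarrow> fiber x \<union> fiber z \<in> S C) \<and>
    (\<forall>x\<in>C. \<forall>i. partner x \<notin> C \<longrightarrow> resolvable_at (S C) (x, i) (x, \<not> i)) \<and>
    (\<forall>x\<in>C. \<forall>i. partner x \<in> C \<longrightarrow>
      hanani_at (S C) (x, i) (insert (x, \<not> i) (fiber (partner x))))" ..
  interpret G: doubled_geometry proj circles S partner parallel
  proof
    have "(9 :: nat) ^ 1 \<le> 9 ^ n" using assms by (intro power_increasing) auto
    thus "card proj \<ge> 3" using card by simp
    show "SQS 20 (C \<times> UNIV) (S C)" if "C \<in> circles" for C
      using S that by simp
    show "fiber x \<union> fiber z \<in> S C" if "C \<in> circles" "x \<in> C" "z \<in> C" "x \<noteq> z" for C x z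
      using S that by simp
    show "resolvable_at (S C) (x, i) (x, \<not> i)" if "C \<in> circles" "x \<in> C" "partner x \<notin> C" for C x i
      using S that by simp
    show "hanani_at (S C) (x, i) (insert (x, \<not> i) (fiber (partner x)))"
      if "C \<in> circles" "x \<in> C" "partner x \<in> C" for C x i
      using S that by simp
    show "C \<inter> C' = {x}" if "C \<in> circles" "C' \<in> circles" "x \<in> C" "x \<in> C'"
      "parallel x C = parallel x C'" "C \<noteq> C'" for C C' x
      using that by (rule parallel_disjoint)
  qed (fact finite_proj circle_card circle_through circle_unique partner parallel)+
  \<comment> \<open>The counting bound behind \<open>mcDSQS_transfer\<close> is applied with the
    order of the field, a multiple of 3.\<close>
  have "(3 :: nat) dvd 9 ^ n"
    using assms by (intro dvd_trans[OF _ dvd_power[of n 9]]) auto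
  moreover have "SQS (2 * 9 ^ n + 2) (proj \<times> UNIV) G.blocks"
    using G.SQS_blocks card by simp
  moreover have "colorable (9 ^ n + 1) (proj \<times> UNIV - {x}) (derived_blocks G.blocks x)"
    if "x \<in> proj \<times> UNIV" for x
    using that G.colorable_derived card by auto
  ultimately show ?thesis by (intro mcDSQS_transfer) auto
qed

end
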